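(* There exists a universal constant $c>0$ such that for every $n \geq 2$ and $1 \leq k \leq n-1$ there exist an origin-symmetric convex body $K \subseteq \mathbb{R}^n$ with $|K|_n = 1$ and an even continuous probability density $f$ in $K$ such that for every linear subspace $F\subseteq \mathbb{R}^n$ of codimension $k$, \[\int_{F} f \leq \left( c \sqrt{\frac{ k\log(n)}{n}}\right)^k .\]
   Context: A convex body is a compact convex set with non-empty interior; $|\cdot|_n$ denotes $n$-dimensional volume. An even continuous probability density in $K$ is an even function $f\ge 0$ that is continuous on $K$ and satisfies $\int_K f = 1$; it is understood to vanish outside $K$, so that $\int_F f=\int_{K\cap F} f$, the integral being with respect to $(n-k)$-dimensional Lebesgue measure on $F$. "Universal constant" means that $c$ does not depend on $n$, $k$ or anything else. *)

theory Defs
  imports "HOL-Analysis.Analysis" "HOL-Library.Function_Algebras"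
begin

text \<open>
  The dimension \<open>n\<close> is quantified inside the theorem (the constant must not depend on it), so
  \<open>\<real>\<^sup>n\<close> is the library's \<^const>\<open>Euclidean_space\<close> \<open>n\<close>: the functions \<open>nat \<Rightarrow> real\<close> vanishing on
  all \<open>i \<ge> n\<close>. The pointwise real vector space structure below makes \<^const>\<open>convex\<close>,
  \<^const>\<open>subspace\<close> and \<^const>\<open>dim\<close> available for it.
\<close>

instantiation "fun" :: (type, real_vector) real_vector
begin

definition scaleR_fun :: "real \<Rightarrow> ('a \<Rightarrow> 'b) \<Rightarrow> 'a \<Rightarrow> 'b"
  where "scaleR_fun r f = (\<lambda>x. r *\<^sub>R f x)"

instance
  by standard (simp_all add: scaleR_fun_def fun_eq_iff scaleR_add_right scaleR_add_left)

end

lemma scaleR_fun_apply [simp]: "(r *\<^sub>R f) x = r *\<^sub>R f x"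
  by (simp add: scaleR_fun_def)

definition dotE :: "nat \<Rightarrow> (nat \<Rightarrow> real) \<Rightarrow> (nat \<Rightarrow> real) \<Rightarrow> real"
  where "dotE n x y = (\<Sum>i<n. x i * y i)"

text \<open>
  \<open>Pi\<^sub>M {..<n} (\<lambda>_. lborel)\<close> lives on functions that are \<^const>\<open>undefined\<close> from \<open>n\<close> on, whereas points
  of \<^const>\<open>Euclidean_space\<close> \<open>n\<close> are \<open>0\<close> there; hence the push-forward. The \<open>borel\<close> sets are those of
  the product topology on \<open>nat \<Rightarrow> real\<close>, which induces the topology of \<^const>\<open>Euclidean_space\<close> \<open>n\<close>.
\<close>

definition lborelE :: "nat \<Rightarrow> (nat \<Rightarrow> real) measure"
  where "lborelE n =
    distr (Pi\<^sub>M {..<n} (\<lambda>_. lborel)) borel (\<lambda>x i. if i < n then x i else 0)"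

definition orthonormal_basis :: "nat \<Rightarrow> (nat \<Rightarrow> real) set \<Rightarrow> (nat \<Rightarrow> nat \<Rightarrow> real) \<Rightarrow> bool"
  where "orthonormal_basis n F b \<longleftrightarrow>
    (\<forall>i<dim F. \<forall>j<dim F. dotE n (b i) (b j) = (if i = j then 1 else 0)) \<and>
    span (b ` {..<dim F}) = F"

text \<open>
  \<open>dim F\<close>-dimensional Lebesgue measure on a linear subspace \<open>F\<close> of \<open>\<real>\<^sup>n\<close>: the image of Lebesgue
  measure on \<open>\<real>\<^bsup>dim F\<^esup>\<close> under the linear isometry onto \<open>F\<close> given by an orthonormal basis of \<open>F\<close>.
  A basis exists (lemma \<open>orthonormal_basis_exists\<close> below), and by rotation invariance of Lebesgue
  measure the result does not depend on which one is chosen.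
\<close>

definition lborel_on_subspace :: "nat \<Rightarrow> (nat \<Rightarrow> real) set \<Rightarrow> (nat \<Rightarrow> real) measure"
  where "lborel_on_subspace n F =
    (let b = (SOME b. orthonormal_basis n F b)
     in distr (lborelE (dim F)) borel (\<lambda>t. \<Sum>j<dim F. t j *\<^sub>R b j))"

definition convex_body :: "nat \<Rightarrow> (nat \<Rightarrow> real) set \<Rightarrow> bool"
  where "convex_body n K \<longleftrightarrow>
    compactin (Euclidean_space n) K \<and> convex K \<and> Euclidean_space n interior_of K \<noteq> {}"

definition even_continuous_density ::
    "nat \<Rightarrow> (nat \<Rightarrow> real) set \<Rightarrow> ((nat \<Rightarrow> real) \<Rightarrow> real) \<Rightarrow> bool"
  where "even_continuous_density n K f \<longleftrightarrow>
    continuous_map (subtopology (Euclidean_space n) K) euclideanreal f \<and>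
    (\<forall>x. f x \<ge> 0) \<and> (\<forall>x. f (- x) = f x) \<and> (\<forall>x. x \<notin> K \<longrightarrow> f x = 0) \<and>
    integral\<^sup>L (lborelE n) f = 1"

lemma orthonormalise:
  assumes "finite B" "independent B" "B \<subseteq> topspace (Euclidean_space n)"
  shows "\<exists>b. (\<forall>i<card B. \<forall>j<card B. dotE n (b i) (b j) = (if i = j then 1 else 0)) \<and>
             span (b ` {..<card B}) = span B"
  using assms
proof (induction B rule: finite_induct)
  case empty
  then show ?case by simp
next
  case (insert v B)
  define m where "m = card B"
  obtain b where on: "\<And>i j. i < m \<Longrightarrow> j < m \<Longrightarrow> dotE n (b i) (b j) = (if i = j then 1 else 0)"
    and sp: "span (b ` {..<m}) = span B"
    using insert independent_insert unfolding m_def by (metis insert_subset)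
  have vB: "v \<notin> span B"
    using insert.prems(1) insert.hyps(2) by (simp add: independent_insert)
  define s where "s = (\<Sum>j<m. dotE n v (b j) *\<^sub>R b j)"
  define w where "w = v - s"
  have sB: "s \<in> span B"
    unfolding s_def sp[symmetric] by (intro span_sum span_scale span_base) auto
  have w0: "w \<noteq> 0" using vB sB by (auto simp: w_def)
  have sub: "subspace (topspace (Euclidean_space n))"
    by (auto simp: subspace_def topspace_Euclidean_space)
  have "span B \<subseteq> topspace (Euclidean_space n)"
    using insert.prems sub by (intro span_minimal) auto
  then have wE: "w \<in> topspace (Euclidean_space n)"
    unfolding w_def using sB sub insert.prems(2) by (intro subspace_diff) auto
  have add: "dotE n (x + y) z = dotE n x z + dotE n y z"
    "dotE n (x - y) z = dotE n x z - dotE n y z"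
    "dotE n (r *\<^sub>R x) z = r * dotE n x z" "dotE n x z = dotE n z x" for x y z r
    by (simp_all add: dotE_def algebra_simps sum.distrib sum_subtractf sum_distrib_left)
  have dsum: "dotE n (\<Sum>j<k. g j) z = (\<Sum>j<k. dotE n (g j) z)" for g z and k :: nat
  proof (induction k)
    case 0
    show ?case by (simp add: dotE_def)
  next
    case (Suc k)
    then show ?case by (simp only: sum.lessThan_Suc add(1))
  qed
  have orth: "dotE n w (b i) = 0" if "i < m" for i
  proof -
    have "dotE n s (b i) = (\<Sum>j<m. dotE n v (b j) * (if j = i then 1 else 0))"
      unfolding s_def dsum add(3) using on that by (intro sum.cong) auto
    also have "\<dots> = dotE n v (b i)" using that by (simp add: mult_if_delta if_distrib cong: if_cong)
    finally show ?thesis by (simp add: w_def add(2))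
  qed
  have pos: "dotE n w w > 0"
  proof -
    obtain i where i: "w i \<noteq> 0" using w0 by (auto simp: fun_eq_iff)
    then have "i < n" using wE leI unfolding topspace_Euclidean_space by blast
    then have "0 < (\<Sum>i<n. w i * w i)"
      using i by (intro sum_pos2[of _ i]) (auto simp: zero_less_mult_iff)
    then show ?thesis by (simp add: dotE_def)
  qed
  define u where "u = (1 / sqrt (dotE n w w)) *\<^sub>R w"
  have uu: "dotE n u u = 1"
  proof -
    have "dotE n u u = (1 / sqrt (dotE n w w)) * ((1 / sqrt (dotE n w w)) * dotE n w w)"
      unfolding u_def by (metis add(3,4))
    then show ?thesis using pos by simp
  qed
  have ub: "dotE n u (b i) = 0" "dotE n (b i) u = 0" if "i < m" for i
    using orth[OF that] add(3,4) by (simp_all add: u_def)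
  define b' where "b' = b(m := u)"
  have img: "b' ` {..<Suc m} = insert u (b ` {..<m})"
    by (auto simp: b'_def lessThan_Suc)
  have m1: "span B \<subseteq> span (insert v B)" and m2: "span B \<subseteq> span (insert u (b ` {..<m}))"
    using span_mono[OF subset_insertI, of B v] span_mono[OF subset_insertI, of "b ` {..<m}" u]
    unfolding sp by blast+
  have "w \<in> span (insert v B)"
    unfolding w_def by (rule span_diff[OF span_base[OF insertI1] subsetD[OF m1 sB]])
  then have uv: "u \<in> span (insert v B)"
    unfolding u_def by (rule span_scale)
  have "v = sqrt (dotE n w w) *\<^sub>R u + s"
  proof -
    have "sqrt (dotE n w w) *\<^sub>R u = w"
      using pos unfolding u_def scaleR_scaleR by simp
    then show ?thesis unfolding w_def by (metis diff_add_cancel)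
  qed
  then have vu: "v \<in> span (insert u (b ` {..<m}))"
    using span_add[OF span_scale[OF span_base[OF insertI1]] subsetD[OF m2 sB]] by metis
  have "b ` {..<m} \<subseteq> span (insert v B)"
    using m1 unfolding sp[symmetric] by (rule order_trans[OF span_superset])
  moreover have "B \<subseteq> span (insert u (b ` {..<m}))"
    by (rule order_trans[OF span_superset m2])
  ultimately have "span (insert u (b ` {..<m})) = span (insert v B)"
    unfolding span_eq using uv vu by blast
  moreover have "card (insert v B) = Suc m" using insert.hyps by (simp add: m_def)
  moreover have "\<forall>i<Suc m. \<forall>j<Suc m. dotE n (b' i) (b' j) = (if i = j then 1 else 0)"
    using on uu ub unfolding b'_def less_Suc_eq by auto
  ultimately show ?case using img by metis
qed

lemma orthonormal_basis_exists:
  assumes "subspace F" "F \<subseteq> topspace (Euclidean_space n)"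
  shows "\<exists>b. orthonormal_basis n F b"
proof -
  define e :: "nat \<Rightarrow> nat \<Rightarrow> real" where "e = (\<lambda>i j. if i = j then 1 else 0)"
  have E: "topspace (Euclidean_space n) \<subseteq> span (e ` {..<n})"
  proof
    fix x :: "nat \<Rightarrow> real" assume x: "x \<in> topspace (Euclidean_space n)"
    have app: "(\<Sum>i<k. g i) j = (\<Sum>i<k. g i j)" for g :: "nat \<Rightarrow> nat \<Rightarrow> real" and j and k :: nat
      by (induction k) auto
    have "x = (\<Sum>i<n. x i *\<^sub>R e i)"
    proof
      fix j
      show "x j = (\<Sum>i<n. x i *\<^sub>R e i) j"
        using x unfolding app
        by (cases "j < n") (auto simp: e_def topspace_Euclidean_space if_distrib cong: if_cong)
    qed
    also have "\<dots> \<in> span (e ` {..<n})"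
      by (intro span_sum span_scale span_base) auto
    finally show "x \<in> span (e ` {..<n})" .
  qed
  obtain B where B: "B \<subseteq> F" "independent B" "F \<subseteq> span B" "card B = dim F"
    using basis_exists by blast
  have "finite B"
    using independent_span_bound[of "e ` {..<n}" B] B assms E by auto
  moreover have "span B = F" using B assms(1) by (metis span_minimal subset_antisym)
  ultimately show ?thesis
    using orthonormalise[of B n] B assms(2) unfolding orthonormal_basis_def by auto
qed

end

theory Submission
  imports Defs "HOL-Probability.Distributions"
begin

text \<open>
  Take \<open>N = n\<^bsup>14k\<^esup>\<close> points \<open>\<plusminus>y\<^sub>i\<close> distributed like a centred Gaussian of variance \<open>m \<approx> n / (k log n)\<close>
  per coordinate, let \<open>K\<close> be the convex hull of these points plus a ball of radius \<open>2 \<surd>n\<close>, and let \<open>f\<close> be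
  the average of the standard Gaussians centred at the points, truncated to \<open>K\<close>.

  A tuple of \<open>m\<close> points has an average within \<open>O(\<surd>n)\<close> of any given point of \<open>K\<close> (Maurey), so \<open>K\<close> is
  covered by \<open>(2N)\<^sup>m = e\<^bsup>O(n)\<^esup>\<close> balls of radius \<open>O(\<surd>n)\<close> and has volume at most \<open>C\<^sup>n\<close>; rescaling to
  volume \<open>1\<close> costs only a factor \<open>C\<^sup>k\<close> in the sections.

  The section of \<open>f\<close> by \<open>F\<close> is, up to \<open>C\<^sup>k\<close>, the average of \<open>exp (- dist(y\<^sub>i, F)\<^sup>2 / 2)\<close>. Its expectation
  is \<open>(1 + m)\<^bsup>-k/2\<^esup>\<close>, which is the required bound, and \<open>N\<close> is large enough for all \<open>F\<close> in a fine net to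
  satisfy it simultaneously. If \<open>k log n > n\<close>, the single point \<open>0\<close> suffices.
\<close>

section \<open>Coordinates and Lebesgue measure\<close>

abbreviation sqE :: "nat \<Rightarrow> (nat \<Rightarrow> real) \<Rightarrow> real"
  where "sqE n x \<equiv> dotE n x x"

lemma sqE_eq: "sqE n x = (\<Sum>i<n. (x i)\<^sup>2)"
  by (simp add: dotE_def power2_eq_square)

lemma sqE_nonneg [simp]: "0 \<le> sqE n x"
  by (simp add: sqE_eq sum_nonneg)

lemma dotE_commute: "dotE n x y = dotE n y x"
  by (simp add: dotE_def mult.commute)

lemma dotE_add_left: "dotE n (x + y) z = dotE n x z + dotE n y z"
  by (simp add: dotE_def algebra_simps sum.distrib)

lemma dotE_diff_left: "dotE n (x - y) z = dotE n x z - dotE n y z"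
  by (simp add: dotE_def algebra_simps sum_subtractf)

lemma dotE_minus_left [simp]: "dotE n (- x) z = - dotE n x z"
  by (simp add: dotE_def sum_negf)

lemma dotE_scaleR_left: "dotE n (r *\<^sub>R x) z = r * dotE n x z"
  by (simp add: dotE_def sum_distrib_left mult.assoc)

lemma dotE_zero_left [simp]: "dotE n 0 z = 0"
  by (simp add: dotE_def)

lemma dotE_add_right: "dotE n z (x + y) = dotE n z x + dotE n z y"
  by (metis dotE_add_left dotE_commute)

lemma dotE_diff_right: "dotE n z (x - y) = dotE n z x - dotE n z y"
  by (metis dotE_diff_left dotE_commute)

lemma dotE_minus_right [simp]: "dotE n z (- x) = - dotE n z x"
  by (metis dotE_minus_left dotE_commute)

lemma dotE_scaleR_right: "dotE n z (r *\<^sub>R x) = r * dotE n z x"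
  by (metis dotE_scaleR_left dotE_commute)

lemma dotE_zero_right [simp]: "dotE n z 0 = 0"
  by (simp add: dotE_def)

lemma dotE_sum_left: "dotE n (\<Sum>j<d. g j) z = (\<Sum>j<d. dotE n (g j) z)" for d :: nat
  by (induction d) (simp_all only: sum.lessThan_Suc dotE_add_left lessThan_0 sum.empty dotE_zero_left)

lemma dotE_sum_right: "dotE n z (\<Sum>j<d. g j) = (\<Sum>j<d. dotE n z (g j))" for d :: nat
  by (induction d) (simp_all only: sum.lessThan_Suc dotE_add_right lessThan_0 sum.empty dotE_zero_right)

lemmas dotE_simps = dotE_add_left dotE_add_right dotE_diff_left dotE_diff_right
  dotE_scaleR_left dotE_scaleR_right

lemma sqE_diff: "sqE n (x - y) = sqE n x - 2 * dotE n x y + sqE n y"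
  by (simp add: dotE_simps dotE_commute[of n y x])

definition nrmE :: "nat \<Rightarrow> (nat \<Rightarrow> real) \<Rightarrow> real"
  where "nrmE n x = sqrt (sqE n x)"

lemma nrmE_L2: "nrmE n x = L2_set x {..<n}"
  by (simp add: nrmE_def sqE_eq L2_set_def)

lemma nrmE_nonneg [simp]: "0 \<le> nrmE n x"
  by (simp add: nrmE_def)

lemma nrmE_sq: "(nrmE n x)\<^sup>2 = sqE n x"
  by (simp add: nrmE_def)

lemma nrmE_triangle: "nrmE n (x + y) \<le> nrmE n x + nrmE n y"
  unfolding nrmE_L2 using L2_set_triangle_ineq[of x y "{..<n}"] by (simp add: plus_fun_def)

lemma nrmE_minus [simp]: "nrmE n (- x) = nrmE n x"
  by (simp add: nrmE_def)

lemma nrmE_scaleR: "nrmE n (r *\<^sub>R x) = \<bar>r\<bar> * nrmE n x"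
  by (simp add: nrmE_def dotE_simps real_sqrt_mult flip: mult.assoc)

lemma dotE_abs_le: "\<bar>dotE n x y\<bar> \<le> nrmE n x * nrmE n y"
proof -
  have "\<bar>dotE n x y\<bar> \<le> (\<Sum>i<n. \<bar>x i\<bar> * \<bar>y i\<bar>)"
    unfolding dotE_def using sum_abs[of "\<lambda>i. x i * y i" "{..<n}"] by (simp add: abs_mult)
  also have "\<dots> \<le> nrmE n x * nrmE n y"
    unfolding nrmE_L2 by (rule L2_set_mult_ineq)
  finally show ?thesis .
qed

lemma dotE_le: "dotE n x y \<le> nrmE n x * nrmE n y"
  using dotE_abs_le[of n x y] by linarith

lemma sum_fun_apply: "(\<Sum>j<d. g j) i = (\<Sum>j<d. g j i)" for g :: "nat \<Rightarrow> nat \<Rightarrow> real" and d :: nat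
  by (induction d) auto

section \<open>Measurability and integration for \<open>lborelE\<close>\<close>

lemma measurable_extend_zero [measurable]:
  "(\<lambda>x (i::nat). if i < n then x i else (0::real)) \<in> borel_measurable (Pi\<^sub>M {..<n} (\<lambda>_. lborel))"
proof (rule measurable_coordinatewise_then_product)
  fix i
  show "(\<lambda>x. if i < n then x i else 0) \<in> borel_measurable (Pi\<^sub>M {..<n} (\<lambda>_. lborel))"
    by (cases "i < n") (auto intro!: measurable_component_singleton)
qed

lemma sets_lborelE [simp, measurable_cong]: "sets (lborelE n) = sets borel"
  by (simp add: lborelE_def)

lemma space_lborelE [simp]: "space (lborelE n) = UNIV"
  by (simp add: lborelE_def)

lemma measurable_dotE [measurable]:
  assumes "f \<in> borel_measurable M" "g \<in> borel_measurable M"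
  shows "(\<lambda>x. dotE n (f x) (g x)) \<in> borel_measurable M"
proof -
  have "(\<lambda>x. f x i) \<in> borel_measurable M" "(\<lambda>x. g x i) \<in> borel_measurable M" for i
    by (rule measurable_product_then_coordinatewise, fact)+
  then show ?thesis unfolding dotE_def by measurable
qed

lemma measurable_fun_diff [measurable]:
  fixes f g :: "'a \<Rightarrow> nat \<Rightarrow> real"
  assumes "f \<in> borel_measurable M" "g \<in> borel_measurable M"
  shows "(\<lambda>x. f x - g x) \<in> borel_measurable M"
  by (rule measurable_coordinatewise_then_product, unfold fun_diff_def,
      intro borel_measurable_diff measurable_product_then_coordinatewise[OF assms(1)]
        measurable_product_then_coordinatewise[OF assms(2)])

lemma measurable_fun_lincomb [measurable]:
  fixes b :: "nat \<Rightarrow> nat \<Rightarrow> real"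
  assumes "f \<in> borel_measurable M"
  shows "(\<lambda>x. \<Sum>j<d. f x j *\<^sub>R b j) \<in> borel_measurable M"
  by (rule measurable_coordinatewise_then_product)
    (simp add: sum_fun_apply borel_measurable_sum borel_measurable_times
      measurable_product_then_coordinatewise[OF assms])

lemma nn_integral_lborelE:
  assumes [measurable]: "f \<in> borel_measurable borel"
  shows "(\<integral>\<^sup>+x. f x \<partial>lborelE n) =
    (\<integral>\<^sup>+x. f (\<lambda>i. if i < n then x i else 0) \<partial>(Pi\<^sub>M {..<n} (\<lambda>_. lborel)))"
  unfolding lborelE_def by (subst nn_integral_distr) auto

text \<open>The cylinders over the cubes \<open>{-k..k}\<close> to the power \<open>n\<close> have
  finite measure and exhaust the space. This is what the later exchange of integrals rests
  on.\<close>

lemma sigma_finite_lborelE: "sigma_finite_measure (lborelE n)"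
proof
  interpret product_sigma_finite "\<lambda>_::nat. lborel :: real measure" ..
  define A :: "nat \<Rightarrow> (nat \<Rightarrow> real) set" where "A k = {x. \<forall>i<n. \<bar>x i\<bar> \<le> real k}" for k
  have meas: "A k \<in> sets borel" for k
  proof -
    have "A k = {x \<in> space borel. \<forall>i\<in>{..<n}. \<bar>x i\<bar> \<le> real k}" by (auto simp: A_def)
    also have "\<dots> \<in> sets borel" by measurable
    finally show ?thesis .
  qed
  have "emeasure (lborelE n) (A k) \<noteq> \<infinity>" for k
  proof -
    have "(\<lambda>x i. if i < n then x i else 0) -` A k \<inter> space (Pi\<^sub>M {..<n} (\<lambda>_. lborel)) =
        Pi\<^sub>E {..<n} (\<lambda>_. {-real k..real k})"
      unfolding A_def space_PiM by (simp add: set_eq_iff PiE_iff abs_le_iff minus_le_iff) blast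
    then have "emeasure (lborelE n) (A k) =
        emeasure (Pi\<^sub>M {..<n} (\<lambda>_. lborel)) (Pi\<^sub>E {..<n} (\<lambda>_. {-real k..real k}))"
      unfolding lborelE_def by (subst emeasure_distr[OF measurable_extend_zero meas]) simp
    also have "\<dots> < \<infinity>"
      by (subst emeasure_PiM) (auto simp: power_less_top_ennreal)
    finally show ?thesis by simp
  qed
  moreover have "(\<Union>k. A k) = UNIV"
  proof -
    have "\<exists>k::nat. \<forall>i<n. \<bar>x i\<bar> \<le> real k" for x :: "nat \<Rightarrow> real"
    proof -
      obtain k :: nat where k: "(\<Sum>i<n. \<bar>x i\<bar>) \<le> real k" using real_arch_simple by blast
      have "\<bar>x i\<bar> \<le> (\<Sum>i<n. \<bar>x i\<bar>)" if "i < n" for i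
        using that by (intro member_le_sum) auto
      then show ?thesis using k by (meson order_trans)
    qed
    then show ?thesis by (auto simp: A_def)
  qed
  ultimately show "\<exists>A. countable A \<and> A \<subseteq> sets (lborelE n) \<and> \<Union>A = space (lborelE n) \<and>
      (\<forall>a\<in>A. emeasure (lborelE n) a \<noteq> \<infinity>)"
    using meas by (intro exI[of _ "range A"]) auto
qed

lemma nn_integral_lborelE_prod:
  assumes [measurable]: "\<And>i. f i \<in> borel_measurable borel"
  shows "(\<integral>\<^sup>+x. (\<Prod>i<n. f i (x i)) \<partial>lborelE n) = (\<Prod>i<n. \<integral>\<^sup>+t. f i t \<partial>lborel)"
proof -
  interpret product_sigma_finite "\<lambda>_::nat. lborel :: real measure" ..
  have "(\<integral>\<^sup>+x. (\<Prod>i<n. f i (x i)) \<partial>lborelE n) =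
      (\<integral>\<^sup>+x. (\<Prod>i<n. f i (x i)) \<partial>(Pi\<^sub>M {..<n} (\<lambda>_. lborel)))"
    by (subst nn_integral_lborelE) auto
  also have "\<dots> = (\<Prod>i<n. \<integral>\<^sup>+t. f i t \<partial>lborel)"
    by (rule product_nn_integral_prod) auto
  finally show ?thesis .
qed

section \<open>Gaussian integrals, with \<open>c\<close> and \<open>s\<close> denoting variances per
  coordinate\<close>

lemma nn_integral_gaussian1:
  assumes "c > 0"
  shows "(\<integral>\<^sup>+t. ennreal (exp (- (t - u)\<^sup>2 / (2 * c))) \<partial>lborel) = ennreal (sqrt (2 * pi * c))"
proof -
  have eq: "exp (- (t - u)\<^sup>2 / (2 * c)) = sqrt (2 * pi * c) * normal_density u (sqrt c) t" for t
    using assms by (simp add: normal_density_def)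
  have "(\<integral>\<^sup>+t. ennreal (normal_density u (sqrt c) t) \<partial>lborel) = 1"
    using assms by (subst nn_integral_eq_integral) auto
  then show ?thesis
    using assms unfolding eq by (subst ennreal_mult) (auto simp: nn_integral_cmult)
qed

lemma nn_integral_gaussianE:
  assumes "c > 0"
  shows "(\<integral>\<^sup>+x. ennreal (exp (- sqE n (x - z) / (2 * c))) \<partial>lborelE n) = ennreal (sqrt (2 * pi * c) ^ n)"
proof -
  have eq: "ennreal (exp (- sqE n (x - z) / (2 * c))) =
      (\<Prod>i<n. ennreal (exp (- (x i - z i)\<^sup>2 / (2 * c))))" for x
    by (simp add: sqE_eq prod_ennreal exp_sum sum_divide_distrib sum_negf[symmetric])
  show ?thesis
    unfolding eq
    by (subst nn_integral_lborelE_prod)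
      (measurable, simp only: nn_integral_gaussian1[OF assms] prod_constant card_lessThan,
        use assms in \<open>simp add: ennreal_power\<close>)
qed

text \<open>Complete the square in every coordinate: the product of Gaussians of variances 1 and
  \<open>s\<close> is a Gaussian of variance \<open>s / (1 + s)\<close> times a factor that depends
  only on \<open>x\<close> and has variance \<open>1 + s\<close>.\<close>

lemma nn_integral_gaussian_conv:
  assumes "s > 0"
  shows "(\<integral>\<^sup>+y. ennreal (exp (- sqE n (x - y) / 2) * exp (- sqE n y / (2 * s))) \<partial>lborelE n) =
    ennreal (sqrt (2 * pi * (s / (1 + s))) ^ n * exp (- sqE n x / (2 * (1 + s))))"
proof -
  define c where "c = s / (1 + s)"
  have c: "c > 0" using assms by (simp add: c_def)
  have *: "(a - t)\<^sup>2 / 2 + t\<^sup>2 / (2 * s) = (t - c * a)\<^sup>2 / (2 * c) + a\<^sup>2 / (2 * (1 + s))" for a t :: real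
  proof -
    have "1 + s \<noteq> 0" using assms by simp
    then show ?thesis using assms
      unfolding c_def by (simp add: divide_simps power2_eq_square) algebra
  qed
  have "sqE n (x - y) / 2 + sqE n y / (2 * s) = sqE n (y - c *\<^sub>R x) / (2 * c) + sqE n x / (2 * (1 + s))" for y
    unfolding sqE_eq using *[of "x _" "y _"]
    by (simp add: sum_divide_distrib sum.distrib[symmetric])
  then have "exp (- sqE n (x - y) / 2) * exp (- sqE n y / (2 * s)) =
      exp (- sqE n x / (2 * (1 + s))) * exp (- sqE n (y - c *\<^sub>R x) / (2 * c))" for y
    unfolding exp_add[symmetric] by (smt (verit) minus_divide_left)
  then have "(\<integral>\<^sup>+y. ennreal (exp (- sqE n (x - y) / 2) * exp (- sqE n y / (2 * s))) \<partial>lborelE n) =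
      (\<integral>\<^sup>+y. ennreal (exp (- sqE n x / (2 * (1 + s)))) *
        ennreal (exp (- sqE n (y - c *\<^sub>R x) / (2 * c))) \<partial>lborelE n)"
    by (simp only: ennreal_mult'[OF exp_ge_zero])
  also have "\<dots> = ennreal (exp (- sqE n x / (2 * (1 + s)))) * ennreal (sqrt (2 * pi * c) ^ n)"
    by (subst nn_integral_cmult) (measurable, simp only: nn_integral_gaussianE[OF c])
  also have "\<dots> = ennreal (sqrt (2 * pi * c) ^ n * exp (- sqE n x / (2 * (1 + s))))"
    by (metis ennreal_mult' exp_ge_zero mult.commute)
  finally show ?thesis unfolding c_def .
qed

section \<open>Distances to subspaces in orthonormal coordinates\<close>

definition orthonormal_family :: "nat \<Rightarrow> nat \<Rightarrow> (nat \<Rightarrow> nat \<Rightarrow> real) \<Rightarrow> bool"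
  where "orthonormal_family n d b \<longleftrightarrow> (\<forall>i<d. \<forall>j<d. dotE n (b i) (b j) = (if i = j then 1 else 0))"

text \<open>For an orthonormal family, this is the squared distance of \<open>y\<close> to the span of \<open>b 0, \<dots>, b (d - 1)\<close>.\<close>

definition sq_dist_span :: "nat \<Rightarrow> nat \<Rightarrow> (nat \<Rightarrow> nat \<Rightarrow> real) \<Rightarrow> (nat \<Rightarrow> real) \<Rightarrow> real"
  where "sq_dist_span n d b y = sqE n y - (\<Sum>j<d. (dotE n y (b j))\<^sup>2)"

lemma sqE_lincomb:
  assumes "orthonormal_family n d b"
  shows "sqE n (\<Sum>j<d. t j *\<^sub>R b j) = sqE d t"
proof -
  have "sqE n (\<Sum>j<d. t j *\<^sub>R b j) = (\<Sum>i<d. \<Sum>j<d. t i * (t j * dotE n (b i) (b j)))"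
    unfolding dotE_sum_left unfolding dotE_sum_right by (simp add: dotE_simps mult.left_commute)
  also have "\<dots> = (\<Sum>i<d. \<Sum>j<d. if j = i then t i * t j else 0)"
    using assms by (intro sum.cong) (auto simp: orthonormal_family_def)
  also have "\<dots> = sqE d t" by (simp add: dotE_def)
  finally show ?thesis .
qed

text \<open>Pythagoras: the numbers \<open>dotE n y (b j)\<close> are the coordinates of the
  orthogonal projection of \<open>y\<close> to the span, and what remains is the distance
  term.\<close>

lemma sqE_lincomb_diff:
  assumes "orthonormal_family n d b"
  shows "sqE n ((\<Sum>j<d. t j *\<^sub>R b j) - y) = sqE d (t - (\<lambda>j. dotE n y (b j))) + sq_dist_span n d b y"
proof -
  have "dotE n (\<Sum>j<d. t j *\<^sub>R b j) y = dotE d t (\<lambda>j. dotE n y (b j))"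
    by (simp add: dotE_sum_left dotE_simps) (simp add: dotE_def[of d] dotE_commute)
  then show ?thesis
    unfolding sqE_diff sqE_lincomb[OF assms] sq_dist_span_def
    by (simp add: dotE_def[of d "\<lambda>j. dotE n y (b j)"] power2_eq_square)
qed

text \<open>Taking \<open>t\<close> in \<open>sqE_lincomb_diff\<close> to be the coordinates of the
  projection exhibits the quantity as a squared norm.\<close>

lemma sq_dist_span_nonneg:
  assumes "orthonormal_family n d b"
  shows "0 \<le> sq_dist_span n d b y"
proof -
  have "sqE n ((\<Sum>j<d. dotE n y (b j) *\<^sub>R b j) - y) = sq_dist_span n d b y"
    unfolding sqE_lincomb_diff[OF assms] by (simp add: dotE_def)
  then show ?thesis by (metis sqE_nonneg)
qed

lemma measurable_sq_dist_span [measurable]: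
  "f \<in> borel_measurable M \<Longrightarrow> (\<lambda>x. sq_dist_span n d b (f x)) \<in> borel_measurable M"
  unfolding sq_dist_span_def
  by (intro borel_measurable_diff borel_measurable_sum borel_measurable_power measurable_dotE) auto

text \<open>By Pythagoras the Gaussian restricted to the span is a constant, determined by the
  distance of \<open>y\<close> to the span, times a \<open>d\<close>-dimensional Gaussian.\<close>

lemma nn_integral_gaussian_section:
  assumes "orthonormal_family n d b" "c > 0"
  shows "(\<integral>\<^sup>+t. ennreal (exp (- sqE n ((\<Sum>j<d. t j *\<^sub>R b j) - y) / (2 * c))) \<partial>lborelE d) =
    ennreal (sqrt (2 * pi * c) ^ d * exp (- sq_dist_span n d b y / (2 * c)))"
proof -
  have "exp (- sqE n ((\<Sum>j<d. t j *\<^sub>R b j) - y) / (2 * c)) =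
      exp (- sq_dist_span n d b y / (2 * c)) * exp (- sqE d (t - (\<lambda>j. dotE n y (b j))) / (2 * c))" for t
    unfolding sqE_lincomb_diff[OF assms(1)] exp_add[symmetric]
    by (simp add: add_divide_distrib diff_divide_distrib)
  then have "(\<integral>\<^sup>+t. ennreal (exp (- sqE n ((\<Sum>j<d. t j *\<^sub>R b j) - y) / (2 * c))) \<partial>lborelE d) =
      (\<integral>\<^sup>+t. ennreal (exp (- sq_dist_span n d b y / (2 * c))) *
        ennreal (exp (- sqE d (t - (\<lambda>j. dotE n y (b j))) / (2 * c))) \<partial>lborelE d)"
    by (simp only: ennreal_mult'[OF exp_ge_zero])
  also have "\<dots> = ennreal (exp (- sq_dist_span n d b y / (2 * c))) * ennreal (sqrt (2 * pi * c) ^ d)"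
    by (subst nn_integral_cmult) (measurable, simp only: nn_integral_gaussianE[OF assms(2)])
  finally show ?thesis
    by (metis ennreal_mult' exp_ge_zero mult.commute)
qed

text \<open>Writing \<open>exp (- sq_dist_span n d b y / 2)\<close> as an integral of a Gaussian over the subspace and exchanging the
  integrals avoids any appeal to the rotation invariance of Lebesgue measure.\<close>

lemma nn_integral_sq_dist_span_gaussian:
  assumes "orthonormal_family n d b" "s > 0" "d \<le> n"
  shows "(\<integral>\<^sup>+y. ennreal (exp (- sq_dist_span n d b y / 2) * exp (- sqE n y / (2 * s))) \<partial>lborelE n) =
    ennreal (sqrt (2 * pi * s) ^ n / sqrt (1 + s) ^ (n - d))"
    (is "?I = _")
proof -
  interpret D: sigma_finite_measure "lborelE d" by (rule sigma_finite_lborelE)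
  interpret N: sigma_finite_measure "lborelE n" by (rule sigma_finite_lborelE)
  interpret P: pair_sigma_finite "lborelE d" "lborelE n" ..
  let ?h = "\<lambda>t y. ennreal (exp (- sqE n ((\<Sum>j<d. t j *\<^sub>R b j) - y) / 2) * exp (- sqE n y / (2 * s)))"
  let ?A = "sqrt (2 * pi * (s / (1 + s))) ^ n"
  \<comment> \<open>The factor \<open>sqrt (2 * pi) ^ d\<close> is the one in
    \<open>nn_integral_gaussian_section\<close> for variance 1. It turns the distance term into an
    inner integral over \<open>t\<close> and is cancelled at the end.\<close>
  have "ennreal (sqrt (2 * pi) ^ d) * ?I =
      (\<integral>\<^sup>+y. ennreal (sqrt (2 * pi) ^ d) * ennreal (exp (- sq_dist_span n d b y / 2) * exp (- sqE n y / (2 * s))) \<partial>lborelE n)"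
    by (subst nn_integral_cmult) auto
  also have "\<dots> = (\<integral>\<^sup>+y. (\<integral>\<^sup>+t. ?h t y \<partial>lborelE d) \<partial>lborelE n)"
  proof (rule nn_integral_cong)
    fix y
    have "(\<integral>\<^sup>+t. ?h t y \<partial>lborelE d) =
        ennreal (sqrt (2 * pi) ^ d * exp (- sq_dist_span n d b y / 2)) * ennreal (exp (- sqE n y / (2 * s)))"
      using nn_integral_gaussian_section[OF assms(1), of 1 y]
      by (simp add: ennreal_mult nn_integral_multc)
    then show "ennreal (sqrt (2 * pi) ^ d) * ennreal (exp (- sq_dist_span n d b y / 2) * exp (- sqE n y / (2 * s))) =
        (\<integral>\<^sup>+t. ?h t y \<partial>lborelE d)"
      by (simp add: ennreal_mult mult.assoc)
  qed
  also have "\<dots> = (\<integral>\<^sup>+t. (\<integral>\<^sup>+y. ?h t y \<partial>lborelE n) \<partial>lborelE d)"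
    by (rule P.Fubini') (simp add: split_beta', measurable)
  also have "\<dots> = (\<integral>\<^sup>+t. ennreal ?A * ennreal (exp (- sqE d (t - 0) / (2 * (1 + s)))) \<partial>lborelE d)"
    unfolding nn_integral_gaussian_conv[OF assms(2)] sqE_lincomb[OF assms(1)]
    using assms(2) by (simp add: ennreal_mult)
  also have "\<dots> = ennreal (?A * sqrt (2 * pi * (1 + s)) ^ d)"
    using assms(2)
    by (subst nn_integral_cmult) (measurable, simp only: nn_integral_gaussianE ennreal_mult'' add_pos_pos
      zero_less_one zero_le_power real_sqrt_ge_zero pi_ge_zero mult_nonneg_nonneg zero_le_numeral add_nonneg_nonneg less_imp_le)
  also have "?A * sqrt (2 * pi * (1 + s)) ^ d =
      sqrt (2 * pi) ^ d * (sqrt (2 * pi * s) ^ n / sqrt (1 + s) ^ (n - d))"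
  proof -
    have "sqrt (1 + s) ^ n = sqrt (1 + s) ^ (n - d) * sqrt (1 + s) ^ d"
      using assms(3) by (simp flip: power_add)
    then show ?thesis using assms(2)
      unfolding real_sqrt_mult real_sqrt_divide power_mult_distrib power_divide
      by (simp add: divide_simps)
  qed
  finally have "ennreal (sqrt (2 * pi) ^ d) * ?I =
    ennreal (sqrt (2 * pi) ^ d) * ennreal (sqrt (2 * pi * s) ^ n / sqrt (1 + s) ^ (n - d))"
    by (simp only: ennreal_mult'[OF zero_le_power[OF real_sqrt_ge_zero]] mult_nonneg_nonneg
      zero_le_numeral pi_ge_zero)
  then show ?thesis by (subst (asm) ennreal_mult_cancel_left) auto
qed

section \<open>Selecting the points\<close>

text \<open>Exponential Markov inequality: on the tail half of the exponent exceeds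
  \<open>n\<close>, so the integrand is at most \<open>exp (- n)\<close> times a Gaussian of
  variance \<open>2 * c\<close>. The loss in total mass is the factor
  \<open>(sqrt 2 / exp 1) ^ n\<close>.\<close>

lemma gaussian_tail:
  assumes "c > 0" "n \<ge> 2"
  shows "(\<integral>\<^sup>+x. ennreal (exp (- sqE n (x - z) / (2 * c))) * indicator {x. sqE n (x - z) > 4 * c * n} x \<partial>lborelE n)
    \<le> ennreal (sqrt (2 * pi * c) ^ n / 3)"
proof -
  have "(\<integral>\<^sup>+x. ennreal (exp (- sqE n (x - z) / (2 * c))) * indicator {x. sqE n (x - z) > 4 * c * n} x \<partial>lborelE n)
      \<le> (\<integral>\<^sup>+x. ennreal (exp (- real n)) * ennreal (exp (- sqE n (x - z) / (2 * (2 * c)))) \<partial>lborelE n)"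
  proof (rule nn_integral_mono)
    fix x
    have "exp (- sqE n (x - z) / (2 * c)) \<le> exp (- real n) * exp (- sqE n (x - z) / (2 * (2 * c)))"
      if "sqE n (x - z) > 4 * c * n"
    proof -
      have "sqE n (x - z) / (4 * c) > real n"
        using that assms by (simp add: pos_less_divide_eq mult.commute)
      moreover have "sqE n (x - z) / (2 * c) = sqE n (x - z) / (4 * c) + sqE n (x - z) / (4 * c)"
        by simp
      ultimately show ?thesis unfolding exp_add[symmetric] by simp
    qed
    then show "ennreal (exp (- sqE n (x - z) / (2 * c))) * indicator {x. sqE n (x - z) > 4 * c * n} x
        \<le> ennreal (exp (- real n)) * ennreal (exp (- sqE n (x - z) / (2 * (2 * c))))"
      by (auto simp: indicator_def simp flip: ennreal_mult intro!: ennreal_leI)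
  qed
  also have "\<dots> = ennreal (exp (- real n)) * ennreal (sqrt (2 * pi * (2 * c)) ^ n)"
    using assms by (subst nn_integral_cmult) (measurable, simp only: nn_integral_gaussianE)
  also have "\<dots> = ennreal (exp (- real n) * sqrt (2 * pi * (2 * c)) ^ n)"
    by (metis ennreal_mult' exp_ge_zero)
  also have "\<dots> \<le> ennreal (sqrt (2 * pi * c) ^ n / 3)"
  proof (rule ennreal_leI)
    \<comment> \<open>The bound 5/2 for e suffices, since 2 / (5/2)^2 = 8/25 < 1/3. The square is
      available because \<open>n\<close> is at least 2.\<close>
    have e: "exp (1::real) \<ge> 5/2" using exp_lower_Taylor_quadratic[of 1] by simp
    have q: "sqrt 2 / exp 1 \<le> 1"
    proof -
      have "sqrt 2 \<le> 2" by (rule real_le_lsqrt) auto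
      then show ?thesis using e by (simp add: divide_simps)
    qed
    have "exp (1::real) ^ 2 \<ge> (5/2) ^ 2" using e by (intro power_mono) auto
    then have sq: "(sqrt 2 / exp 1) ^ 2 \<le> (1/3 :: real)"
      by (simp add: power_divide divide_simps power2_eq_square)
    have "exp (- real n) * sqrt (2 * pi * (2 * c)) ^ n = (sqrt 2 / exp 1) ^ n * sqrt (2 * pi * c) ^ n"
    proof -
      have "sqrt (2 * pi * (2 * c)) = sqrt 2 * sqrt (2 * pi * c)"
        by (simp add: real_sqrt_mult)
      moreover have "exp (- real n) = 1 / exp 1 ^ n"
        by (simp add: exp_minus inverse_eq_divide exp_of_nat_mult[of n 1, simplified])
      ultimately show ?thesis by (simp add: power_mult_distrib power_divide)
    qed
    also have "(sqrt 2 / exp 1) ^ n \<le> (sqrt 2 / exp 1) ^ 2"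
      using q assms by (intro power_decreasing) auto
    also note sq
    finally show "exp (- real n) * sqrt (2 * pi * (2 * c)) ^ n \<le> sqrt (2 * pi * c) ^ n / 3"
      using assms by (simp add: mult_right_mono)
  qed
  finally show ?thesis .
qed

text \<open>Total mass minus the tail. It serves twice: to find points of bounded norm, and to show
  that truncation to the body keeps most of the mass.\<close>

lemma gaussian_ball:
  assumes "c > 0" "n \<ge> 2"
  shows "ennreal (2/3 * sqrt (2 * pi * c) ^ n) \<le>
    (\<integral>\<^sup>+x. ennreal (exp (- sqE n (x - z) / (2 * c))) * indicator {x. sqE n (x - z) \<le> 4 * c * n} x \<partial>lborelE n)"
    (is "_ \<le> ?I")
proof -
  let ?G = "sqrt (2 * pi * c) ^ n"
  let ?J = "\<integral>\<^sup>+x. ennreal (exp (- sqE n (x - z) / (2 * c))) * indicator {x. sqE n (x - z) > 4 * c * n} x \<partial>lborelE n"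
  have G: "?G \<ge> 0" using assms by simp
  have "ennreal ?G = (\<integral>\<^sup>+x. ennreal (exp (- sqE n (x - z) / (2 * c))) \<partial>lborelE n)"
    using nn_integral_gaussianE[OF assms(1)] by simp
  also have "\<dots> = (\<integral>\<^sup>+x. ennreal (exp (- sqE n (x - z) / (2 * c))) * indicator {x. sqE n (x - z) \<le> 4 * c * n} x +
      ennreal (exp (- sqE n (x - z) / (2 * c))) * indicator {x. sqE n (x - z) > 4 * c * n} x \<partial>lborelE n)"
    by (intro nn_integral_cong) (auto simp: indicator_def)
  also have "\<dots> = ?I + ?J"
    by (rule nn_integral_add) measurable
  also have "\<dots> \<le> ?I + ennreal (?G / 3)"
    using gaussian_tail[OF assms] by (intro add_left_mono)
  finally have "ennreal ?G \<le> ?I + ennreal (?G / 3)" .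
  then have "ennreal ?G - ennreal (?G / 3) \<le> ?I"
    by (simp add: ennreal_minus_le_iff add.commute)
  moreover have "ennreal ?G - ennreal (?G / 3) = ennreal (2/3 * ?G)"
    using G by (subst ennreal_minus) auto
  ultimately show ?thesis by simp
qed

text \<open>Under the centred Gaussian of variance \<open>s\<close> each
  \<open>exp (- sq_dist_span n d b y / 2)\<close> has mean
  \<open>1 / sqrt (1 + s) ^ (n - d)\<close>. If the weighted sum exceeded twice its mean on the
  whole ball, whose probability is at least 2/3, then the mean would be at least 4/3 of
  itself.\<close>

lemma exists_point_below_average:
  fixes s :: real
  assumes "n \<ge> 2" "s > 0" "d \<le> n" "finite E" "\<And>b. b \<in> E \<Longrightarrow> orthonormal_family n d b" "\<And>b. b \<in> E \<Longrightarrow> W b \<ge> 0"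
  shows "\<exists>y\<in>topspace (Euclidean_space n). sqE n y \<le> 4 * s * n \<and>
    (\<Sum>b\<in>E. W b * exp (- sq_dist_span n d b y / 2)) \<le> 2 / sqrt (1 + s) ^ (n - d) * (\<Sum>b\<in>E. W b)"
proof (rule ccontr)
  let ?W = "\<Sum>b\<in>E. W b" and ?p = "1 / sqrt (1 + s) ^ (n - d)" and ?G = "sqrt (2 * pi * s) ^ n"
  let ?S = "\<lambda>y. \<Sum>b\<in>E. W b * exp (- sq_dist_span n d b y / 2)"
  have G: "?G > 0" and p: "?p > 0" using assms by auto
  have W0: "?W \<ge> 0" using assms by (intro sum_nonneg)
  assume no: "\<not> ?thesis"
  have gt: "2 * ?p * ?W < ?S y" if "sqE n y \<le> 4 * s * n" for y
  proof -
    \<comment> \<open>The negated claim concerns only points of \<open>Euclidean_space n\<close>,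
      whereas the integrals run over all functions. Clearing the coordinates from \<open>n\<close>
      on changes neither quantity.\<close>
    let ?y = "\<lambda>i. if i < n then y i else 0"
    have "dotE n ?y z = dotE n y z" "dotE n z ?y = dotE n z y" for z by (simp_all add: dotE_def)
    then have eq: "sqE n ?y = sqE n y" "sq_dist_span n d b ?y = sq_dist_span n d b y" for b by (simp_all add: sq_dist_span_def)
    have "?y \<in> topspace (Euclidean_space n)" by (simp add: topspace_Euclidean_space)
    then have "\<not> (sqE n ?y \<le> 4 * s * n \<and> ?S ?y \<le> 2 / sqrt (1 + s) ^ (n - d) * ?W)"
      using no bexI by fast
    then show ?thesis using that unfolding eq by simp
  qed
  \<comment> \<open>With total weight 0 the strict inequality \<open>gt\<close> fails at the origin.
    A positive weight is what makes the final comparison of 4/3 with 1 contradictory.\<close>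
  have Wpos: "?W > 0"
  proof (rule ccontr)
    assume "\<not> ?W > 0"
    then have "?W = 0" using W0 by simp
    then have "\<forall>b\<in>E. W b = 0" using assms by (simp add: sum_nonneg_eq_0_iff)
    then show False using gt[of 0] assms by simp
  qed
  have "ennreal (2 * ?p * ?W) * ennreal (2/3 * ?G) \<le> ennreal (2 * ?p * ?W) *
      (\<integral>\<^sup>+y. ennreal (exp (- sqE n (y - 0) / (2 * s))) * indicator {y. sqE n (y - 0) \<le> 4 * s * n} y \<partial>lborelE n)"
    using gaussian_ball[OF assms(2,1), of 0] by (intro mult_left_mono) auto
  also have "\<dots> = (\<integral>\<^sup>+y. ennreal (2 * ?p * ?W) *
      (ennreal (exp (- sqE n (y - 0) / (2 * s))) * indicator {y. sqE n (y - 0) \<le> 4 * s * n} y) \<partial>lborelE n)"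
    by (rule nn_integral_cmult[symmetric]) measurable
  also have "\<dots> \<le> (\<integral>\<^sup>+y. (\<Sum>b\<in>E. ennreal (W b) * ennreal (exp (- sq_dist_span n d b y / 2) * exp (- sqE n y / (2 * s)))) \<partial>lborelE n)"
  proof (rule nn_integral_mono)
    fix y
    have "(\<Sum>b\<in>E. ennreal (W b) * ennreal (exp (- sq_dist_span n d b y / 2) * exp (- sqE n y / (2 * s)))) =
        (\<Sum>b\<in>E. ennreal (W b * (exp (- sq_dist_span n d b y / 2) * exp (- sqE n y / (2 * s)))))"
      using assms by (intro sum.cong refl) (simp add: ennreal_mult)
    also have "\<dots> = ennreal (?S y * exp (- sqE n y / (2 * s)))"
      using assms by (subst sum_ennreal) (auto simp: sum_distrib_right mult.assoc)
    finally have eq: "(\<Sum>b\<in>E. ennreal (W b) * ennreal (exp (- sq_dist_span n d b y / 2) * exp (- sqE n y / (2 * s)))) =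
      ennreal (?S y * exp (- sqE n y / (2 * s)))" .
    show "ennreal (2 * ?p * ?W) *
      (ennreal (exp (- sqE n (y - 0) / (2 * s))) * indicator {y. sqE n (y - 0) \<le> 4 * s * n} y) \<le>
      (\<Sum>b\<in>E. ennreal (W b) * ennreal (exp (- sq_dist_span n d b y / 2) * exp (- sqE n y / (2 * s))))"
    proof (cases "sqE n y \<le> 4 * s * n")
      case True
      have "ennreal (2 * ?p * ?W) * ennreal (exp (- sqE n y / (2 * s))) =
          ennreal ((2 * ?p * ?W) * exp (- sqE n y / (2 * s)))"
        by (metis ennreal_mult'' exp_ge_zero)
      also have "\<dots> \<le> ennreal (?S y * exp (- sqE n y / (2 * s)))"
        using gt[OF True] by (intro ennreal_leI mult_right_mono) auto
      finally show ?thesis using True unfolding eq by simp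
    qed simp
  qed
  also have "\<dots> = (\<Sum>b\<in>E. ennreal (W b) * (\<integral>\<^sup>+y. ennreal (exp (- sq_dist_span n d b y / 2) * exp (- sqE n y / (2 * s))) \<partial>lborelE n))"
    by (subst nn_integral_sum) (measurable, simp add: nn_integral_cmult)
  also have "\<dots> = (\<Sum>b\<in>E. ennreal (W b * (?G * ?p)))"
    using assms(6) G p
    by (intro sum.cong refl, subst nn_integral_sq_dist_span_gaussian[OF assms(5) assms(2,3)])
      (simp_all flip: ennreal_mult)
  also have "\<dots> = ennreal (?W * (?G * ?p))"
    using assms(6) G p by (subst sum_ennreal) (auto simp: sum_distrib_right sum_divide_distrib)
  finally have "ennreal ((2 * ?p * ?W) * (2/3 * ?G)) \<le> ennreal (?W * (?G * ?p))"
    using p G W0 by (subst ennreal_mult) auto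
  then have "(2 * ?p * ?W) * (2/3 * ?G) \<le> ?W * (?G * ?p)"
    using p G W0 by (subst (asm) ennreal_le_iff) auto
  then have "4/3 * (?W * (?G * ?p)) \<le> ?W * (?G * ?p)" by (simp add: mult_ac)
  moreover have "?W * (?G * ?p) > 0" using Wpos G p by (intro mult_pos_pos)
  ultimately show False by linarith
qed

text \<open>The method of conditional expectations: the \<open>i\<close>-th point is chosen so as not to increase
  \<open>\<Sum>e\<in>E. \<Prod>j<i. (1 + \<phi> e (y j))\<close> by more than the factor \<open>1 + q\<close>.\<close>

lemma greedy_selection:
  fixes \<phi> :: "'e \<Rightarrow> 'y \<Rightarrow> real"
  assumes "finite E" "q \<ge> 0"
    and \<phi>: "\<And>e y. e \<in> E \<Longrightarrow> 0 \<le> \<phi> e y" "\<And>e y. e \<in> E \<Longrightarrow> \<phi> e y \<le> 1"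
    and step: "\<And>W. (\<And>e. e \<in> E \<Longrightarrow> 0 \<le> W e) \<Longrightarrow> \<exists>y\<in>B. (\<Sum>e\<in>E. W e * \<phi> e y) \<le> q * (\<Sum>e\<in>E. W e)"
  shows "\<exists>y :: nat \<Rightarrow> 'y. (\<forall>i<N. y i \<in> B) \<and>
    (\<forall>e\<in>E. (\<Sum>i<N. \<phi> e (y i)) \<le> 2 * (ln (real (card E)) + q * real N))"
proof -
  have "\<exists>y :: nat \<Rightarrow> 'y. (\<forall>i<N. y i \<in> B) \<and>
    (\<Sum>e\<in>E. \<Prod>i<N. 1 + \<phi> e (y i)) \<le> real (card E) * (1 + q) ^ N"
  proof (induction N)
    case 0
    show ?case by simp
  next
    case (Suc N)
    then obtain y where y: "\<forall>i<N. y i \<in> B"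
      "(\<Sum>e\<in>E. \<Prod>i<N. 1 + \<phi> e (y i)) \<le> real (card E) * (1 + q) ^ N" by blast
    let ?W = "\<lambda>e. \<Prod>i<N. 1 + \<phi> e (y i)"
    have "0 \<le> ?W e" if "e \<in> E" for e
      using \<phi>(1)[OF that] by (intro prod_nonneg) (auto simp: add_nonneg_nonneg)
    then obtain z where z: "z \<in> B" "(\<Sum>e\<in>E. ?W e * \<phi> e z) \<le> q * (\<Sum>e\<in>E. ?W e)"
      using step[of ?W] by blast
    let ?y = "y(N := z)"
    have "(\<Sum>e\<in>E. \<Prod>i<Suc N. 1 + \<phi> e (?y i)) = (\<Sum>e\<in>E. ?W e) + (\<Sum>e\<in>E. ?W e * \<phi> e z)"
      by (simp add: distrib_left sum.distrib)
    also have "\<dots> \<le> (1 + q) * (\<Sum>e\<in>E. ?W e)"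
      using z(2) by (simp add: distrib_right)
    also have "\<dots> \<le> (1 + q) * (real (card E) * (1 + q) ^ N)"
      using y(2) assms(2) by (intro mult_left_mono) auto
    finally have "(\<Sum>e\<in>E. \<Prod>i<Suc N. 1 + \<phi> e (?y i)) \<le> real (card E) * (1 + q) ^ Suc N"
      by (simp add: mult_ac)
    moreover have "\<forall>i<Suc N. ?y i \<in> B" using y(1) z(1) by (auto simp: less_Suc_eq)
    ultimately show ?case by blast
  qed
  then obtain y where y: "\<forall>i<N. y i \<in> B"
    "(\<Sum>e\<in>E. \<Prod>i<N. 1 + \<phi> e (y i)) \<le> real (card E) * (1 + q) ^ N" by blast
  have "(\<Sum>i<N. \<phi> e (y i)) \<le> 2 * (ln (real (card E)) + q * real N)" if e: "e \<in> E" for e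
  proof -
    have card: "card E > 0" using e assms(1) card_gt_0_iff by blast
    \<comment> \<open>This bound passes from the product back to the exponential of half the sum,
      which is the origin of the factor 2 in the claim.\<close>
    have half: "exp (x / 2) \<le> 1 + x" if "0 \<le> x" "x \<le> 1" for x :: real
    proof -
      have "exp (x / 2) \<le> 1 + x / 2 + (x / 2)\<^sup>2" using that by (intro exp_bound) auto
      moreover have "x * x \<le> 1 * x" using that by (intro mult_right_mono) auto
      ultimately show ?thesis using that by (simp add: power2_eq_square field_simps)
    qed
    have "exp ((\<Sum>i<N. \<phi> e (y i)) / 2) = (\<Prod>i<N. exp (\<phi> e (y i) / 2))"
      by (simp add: exp_sum sum_divide_distrib)
    also have "\<dots> \<le> (\<Prod>i<N. 1 + \<phi> e (y i))"
      using half \<phi>[OF e] by (intro prod_mono) auto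
    \<comment> \<open>One nonnegative summand is at most the whole potential, so a single bound
      controls every \<open>e\<close> in \<open>E\<close> at once.\<close>
    also have "\<dots> \<le> (\<Sum>e\<in>E. \<Prod>i<N. 1 + \<phi> e (y i))"
      using assms(1) e \<phi>(1) by (intro member_le_sum) (auto intro!: prod_nonneg add_nonneg_nonneg)
    also have "\<dots> \<le> real (card E) * (1 + q) ^ N" by (rule y(2))
    also have "\<dots> \<le> real (card E) * exp q ^ N"
      using assms(2) by (intro mult_left_mono power_mono) (auto simp: add.commute)
    also have "\<dots> = exp (ln (real (card E)) + q * real N)"
      using card by (simp add: exp_add exp_of_nat_mult[symmetric] mult.commute)
    finally show ?thesis by simp
  qed
  then show ?thesis using y(1) by blast
qed

section \<open>Nets of orthonormal families, and spread point systems\<close>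

lemma orthonormal_family_coord_le:
  assumes "orthonormal_family n d b" "j < d" "i < n"
  shows "\<bar>b j i\<bar> \<le> 1"
proof -
  have "(b j i)\<^sup>2 \<le> sqE n (b j)"
    unfolding sqE_eq using assms by (intro member_le_sum) auto
  also have "\<dots> = 1" using assms by (simp add: orthonormal_family_def)
  finally show ?thesis by (simp add: abs_square_le_1)
qed

text \<open>Round the \<open>d * n\<close> entries, which lie in [-1, 1], down to multiples of
  \<open>1 / M\<close>; each takes at most \<open>2 * M + 1\<close> values. One orthonormal
  representative is picked from every rounding class by \<open>inv_into\<close>, so the net itself
  consists of orthonormal families.\<close>

lemma orthonormal_family_net:
  assumes "M > 0"
  shows "\<exists>E. finite E \<and> (\<forall>b\<in>E. orthonormal_family n d b) \<and> card E \<le> (2 * M + 1) ^ (d * n) \<and>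
    (\<forall>b. orthonormal_family n d b \<longrightarrow> (\<exists>b'\<in>E. \<forall>j<d. \<forall>i<n. \<bar>b j i - b' j i\<bar> \<le> 1 / real M))"
proof -
  define S where "S = {b. orthonormal_family n d b}"
  define h where "h b = (\<lambda>p\<in>{..<d} \<times> {..<n}. \<lfloor>real M * b (fst p) (snd p)\<rfloor>)" for b :: "nat \<Rightarrow> nat \<Rightarrow> real"
  let ?P = "({..<d} \<times> {..<n}) \<rightarrow>\<^sub>E {- int M..int M}"
  have finP: "finite ?P" by (intro finite_PiE) auto
  have sub: "h ` S \<subseteq> ?P"
  proof
    fix f assume "f \<in> h ` S"
    then obtain b where b: "orthonormal_family n d b" "f = h b" by (auto simp: S_def)
    have "- int M \<le> \<lfloor>real M * b j i\<rfloor> \<and> \<lfloor>real M * b j i\<rfloor> \<le> int M" if "j < d" "i < n" for i j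
    proof -
      have "- 1 \<le> b j i" "b j i \<le> 1" using orthonormal_family_coord_le[OF b(1) that] by auto
      then have "real M * (- 1) \<le> real M * b j i" "real M * b j i \<le> real M * 1"
        by (intro mult_left_mono; simp)+
      then show ?thesis by (auto simp: le_floor_iff floor_le_iff)
    qed
    then show "f \<in> ?P" by (auto simp: b h_def)
  qed
  define E where "E = inv_into S h ` (h ` S)"
  have "finite (h ` S)" using sub finP finite_subset by blast
  moreover have "card E \<le> (2 * M + 1) ^ (d * n)"
  proof -
    have "card E \<le> card (h ` S)" unfolding E_def using calculation by (rule card_image_le)
    also have "\<dots> \<le> card ?P" using sub finP by (rule card_mono[rotated])
    also have "\<dots> = (2 * M + 1) ^ (d * n)"
    proof -
      have "card {- int M..int M} = 2 * M + 1" by simp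
      then show ?thesis by (simp only: card_PiE card_cartesian_product finite_cartesian_product
        finite_lessThan prod_constant card_lessThan)
    qed
    finally show ?thesis .
  qed
  moreover have "orthonormal_family n d b" if "b \<in> E" for b
    using that inv_into_into[of _ h S] by (auto simp: E_def S_def)
  moreover have "\<exists>b'\<in>E. \<forall>j<d. \<forall>i<n. \<bar>b j i - b' j i\<bar> \<le> 1 / real M" if b: "orthonormal_family n d b" for b
  proof -
    define b' where "b' = inv_into S h (h b)"
    have b'E: "b' \<in> E" unfolding E_def b'_def using b
      by (intro imageI[where f="inv_into S h"] imageI[where f=h]) (simp add: S_def)
    have "h b' = h b" unfolding b'_def using b
      by (intro f_inv_into_f[where f=h]) (simp add: S_def)
    have "\<bar>b j i - b' j i\<bar> \<le> 1 / real M" if "j < d" "i < n" for i j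
    proof -
      have "\<lfloor>real M * b j i\<rfloor> = \<lfloor>real M * b' j i\<rfloor>"
        using fun_cong[OF \<open>h b' = h b\<close>, of "(j, i)"] that by (simp add: h_def)
      then have "\<bar>real M * b j i - real M * b' j i\<bar> \<le> 1" by linarith
      also have "\<bar>real M * b j i - real M * b' j i\<bar> = real M * \<bar>b j i - b' j i\<bar>"
        by (simp add: abs_mult flip: right_diff_distrib)
      finally show ?thesis using assms by (simp add: field_simps)
    qed
    then show ?thesis using b'E by blast
  qed
  ultimately show ?thesis unfolding E_def by (intro exI[of _ E]) (auto simp: E_def)
qed

text \<open>Factor the differences of squares. Entrywise closeness gives
  \<open>nrmE n (b j - b' j)\<close> at most \<open>n * \<delta>\<close>, so an inner product with
  \<open>y\<close> moves by at most \<open>n * \<delta> * nrmE n y\<close>, while two such inner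
  products add up to at most \<open>2 * nrmE n y\<close>. There are at most \<open>n\<close> indices
  \<open>j\<close>.\<close>

lemma sq_dist_span_perturb:
  assumes "orthonormal_family n d b" "orthonormal_family n d b'" "d \<le> n" "\<delta> \<ge> 0"
    and close: "\<And>j i. j < d \<Longrightarrow> i < n \<Longrightarrow> \<bar>b j i - b' j i\<bar> \<le> \<delta>"
  shows "sq_dist_span n d b' y \<le> sq_dist_span n d b y + 2 * n\<^sup>2 * \<delta> * sqE n y"
proof -
  let ?r = "nrmE n y"
  have one: "nrmE n (c j) = 1" if "orthonormal_family n d c" "j < d" for c j
    using that by (simp add: nrmE_def orthonormal_family_def)
  have "(dotE n y (b j))\<^sup>2 - (dotE n y (b' j))\<^sup>2 \<le> 2 * n * \<delta> * sqE n y" if j: "j < d" for j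
  proof -
    have "nrmE n (b j - b' j) \<le> (\<Sum>i<n. \<bar>(b j - b' j) i\<bar>)"
      unfolding nrmE_L2 by (rule L2_set_le_sum_abs)
    also have "\<dots> \<le> (\<Sum>i<n. \<delta>)" using close j by (intro sum_mono) auto
    finally have nd: "nrmE n (b j - b' j) \<le> n * \<delta>" by simp
    have "\<bar>dotE n y (b j) - dotE n y (b' j)\<bar> \<le> ?r * nrmE n (b j - b' j)"
      using dotE_abs_le[of n y "b j - b' j"] by (simp add: dotE_simps)
    also have "\<dots> \<le> ?r * (n * \<delta>)" using nd by (intro mult_left_mono) auto
    finally have d1: "\<bar>dotE n y (b j) - dotE n y (b' j)\<bar> \<le> ?r * (n * \<delta>)" .
    have "\<bar>dotE n y (b j)\<bar> \<le> ?r" "\<bar>dotE n y (b' j)\<bar> \<le> ?r"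
      using dotE_abs_le[of n y "b j"] dotE_abs_le[of n y "b' j"] one[OF assms(1) j] one[OF assms(2) j] by auto
    then have d2: "\<bar>dotE n y (b j) + dotE n y (b' j)\<bar> \<le> 2 * ?r" by linarith
    have "(dotE n y (b j))\<^sup>2 - (dotE n y (b' j))\<^sup>2 \<le>
        \<bar>dotE n y (b j) - dotE n y (b' j)\<bar> * \<bar>dotE n y (b j) + dotE n y (b' j)\<bar>"
      unfolding abs_mult[symmetric] by (simp add: power2_eq_square algebra_simps abs_if)
    also have "\<dots> \<le> (?r * (n * \<delta>)) * (2 * ?r)"
      using d1 d2 assms by (intro mult_mono) auto
    also have "\<dots> = 2 * n * \<delta> * sqE n y" by (simp flip: nrmE_sq add: power2_eq_square)
    finally show ?thesis .
  qed
  then have "(\<Sum>j<d. (dotE n y (b j))\<^sup>2 - (dotE n y (b' j))\<^sup>2) \<le> (\<Sum>j<d. 2 * n * \<delta> * sqE n y)"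
    by (intro sum_mono) auto
  also have "\<dots> = d * (2 * n * \<delta> * sqE n y)" by simp
  also have "\<dots> \<le> n * (2 * n * \<delta> * sqE n y)"
    using assms by (intro mult_right_mono) auto
  finally show ?thesis
    unfolding sq_dist_span_def by (simp add: sum_subtractf power2_eq_square algebra_simps)
qed

text \<open>Greedy selection over the net, then transfer to all families. By the bound on
  \<open>M\<close> the transfer changes a squared distance by at most 1 and costs a factor
  \<open>exp (1/2)\<close>, at most 2. By the bound on \<open>N\<close> the logarithm of the net
  size is at most the mean term. The constant is 12 = 2 * 2 * (1 + 2): transfer,
  \<open>greedy_selection\<close>, and logarithm plus twice the mean.\<close>

lemma exists_spread_points:
  fixes n d M N :: nat and s :: real
  assumes "n \<ge> 2" "d \<le> n" "s > 0" "M > 0" "8 * s * real n ^ 3 \<le> real M"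
    and N: "real (n * n) * ln (2 * real M + 1) \<le> real N / sqrt (1 + s) ^ (n - d)"
  shows "\<exists>y. (\<forall>i<N. y i \<in> topspace (Euclidean_space n) \<and> sqE n (y i) \<le> 4 * s * n) \<and>
    (\<forall>b. orthonormal_family n d b \<longrightarrow> (\<Sum>i<N. exp (- sq_dist_span n d b (y i) / 2)) \<le> 12 * real N / sqrt (1 + s) ^ (n - d))"
proof -
  let ?p = "1 / sqrt (1 + s) ^ (n - d)"
  have p: "?p > 0" using assms by auto
  obtain E where "finite E \<and> (\<forall>b\<in>E. orthonormal_family n d b) \<and> card E \<le> (2 * M + 1) ^ (d * n) \<and>
    (\<forall>b. orthonormal_family n d b \<longrightarrow> (\<exists>b'\<in>E. \<forall>j<d. \<forall>i<n. \<bar>b j i - b' j i\<bar> \<le> 1 / real M))"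
    using orthonormal_family_net[OF assms(4), of n d] ..
  then have E: "finite E" "\<And>b. b \<in> E \<Longrightarrow> orthonormal_family n d b" "card E \<le> (2 * M + 1) ^ (d * n)"
    "\<And>b. orthonormal_family n d b \<Longrightarrow> \<exists>b'\<in>E. \<forall>j<d. \<forall>i<n. \<bar>b j i - b' j i\<bar> \<le> 1 / real M"
    by simp_all
  let ?B = "{y \<in> topspace (Euclidean_space n). sqE n y \<le> 4 * s * n}"
  have "\<exists>y :: nat \<Rightarrow> nat \<Rightarrow> real. (\<forall>i<N. y i \<in> ?B) \<and>
    (\<forall>b\<in>E. (\<Sum>i<N. exp (- sq_dist_span n d b (y i) / 2)) \<le> 2 * (ln (real (card E)) + 2 * ?p * real N))"
  proof (rule greedy_selection)
    show "\<exists>y\<in>?B. (\<Sum>b\<in>E. W b * exp (- sq_dist_span n d b y / 2)) \<le> 2 * ?p * (\<Sum>b\<in>E. W b)"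
      if "\<And>b. b \<in> E \<Longrightarrow> 0 \<le> W b" for W
      using exists_point_below_average[of n s d E W] assms E that by auto
  qed (use E p sq_dist_span_nonneg in auto)
  then obtain y where y: "\<forall>i<N. y i \<in> ?B"
    "\<And>b. b \<in> E \<Longrightarrow> (\<Sum>i<N. exp (- sq_dist_span n d b (y i) / 2)) \<le> 2 * (ln (real (card E)) + 2 * ?p * real N)"
    by blast
  have "(\<Sum>i<N. exp (- sq_dist_span n d b (y i) / 2)) \<le> 12 * real N / sqrt (1 + s) ^ (n - d)"
    if b: "orthonormal_family n d b" for b
  proof -
    obtain b' where b': "b' \<in> E" "\<forall>j<d. \<forall>i<n. \<bar>b j i - b' j i\<bar> \<le> 1 / real M"
      using E(4)[OF b] by blast
    have "card E > 0" using b' E(1) card_gt_0_iff by blast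
    then have "ln (real (card E)) \<le> ln (real ((2 * M + 1) ^ (d * n)))"
      using of_nat_mono[OF E(3)] by (intro ln_mono) simp_all
    also have "\<dots> = real (d * n) * ln (2 * real M + 1)"
      by (simp add: ln_realpow add.commute)
    also have "\<dots> \<le> real (n * n) * ln (2 * real M + 1)"
      using assms by (intro mult_right_mono) (auto simp del: of_nat_mult)
    also have "\<dots> \<le> ?p * real N" using N by simp
    finally have lnE: "ln (real (card E)) \<le> ?p * real N" .
    have "exp (- sq_dist_span n d b (y i) / 2) \<le> 2 * exp (- sq_dist_span n d b' (y i) / 2)" if i: "i < N" for i
    proof -
      have "sq_dist_span n d b' (y i) \<le> sq_dist_span n d b (y i) + 2 * n\<^sup>2 * (1 / real M) * sqE n (y i)"
        using sq_dist_span_perturb[OF b E(2)[OF b'(1)] assms(2), of "1 / real M" "y i"] b'(2) by simp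
      also have "2 * n\<^sup>2 * (1 / real M) * sqE n (y i) \<le> 2 * n\<^sup>2 * (1 / real M) * (4 * s * n)"
        using y(1) i by (intro mult_left_mono) auto
      also have "\<dots> = 8 * s * real n ^ 3 / real M"
        by (simp add: power2_eq_square power3_eq_cube)
      also have "\<dots> \<le> 1" using assms by (simp add: divide_simps)
      finally have "- sq_dist_span n d b (y i) / 2 \<le> 1/2 + - sq_dist_span n d b' (y i) / 2" by simp
      then have "exp (- sq_dist_span n d b (y i) / 2) \<le> exp (1/2) * exp (- sq_dist_span n d b' (y i) / 2)"
        unfolding exp_add[symmetric] by simp
      also have "exp (1/2 :: real) \<le> 2"
        using exp_bound[of "1/2"] by (simp add: power2_eq_square)
      finally show ?thesis by simp
    qed
    then have "(\<Sum>i<N. exp (- sq_dist_span n d b (y i) / 2)) \<le> 2 * (\<Sum>i<N. exp (- sq_dist_span n d b' (y i) / 2))"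
      unfolding sum_distrib_left by (intro sum_mono) auto
    also have "\<dots> \<le> 2 * (2 * (ln (real (card E)) + 2 * ?p * real N))"
      using y(2)[OF b'(1)] by simp
    also have "\<dots> \<le> 12 * (?p * real N)" using lnE by simp
    finally show ?thesis by simp
  qed
  then show ?thesis using y(1) by blast
qed

section \<open>The convex body\<close>

text \<open>For finite nonempty \<open>Y\<close>, this is \<open>conv Y\<close> plus the ball of radius \<open>r\<close>, described by its support function
  \<open>u \<mapsto> max\<^bsub>y\<in>Y\<^esub> \<langle>y, u\<rangle> + r |u|\<close>.\<close>

definition blurred_hull :: "nat \<Rightarrow> (nat \<Rightarrow> real) set \<Rightarrow> real \<Rightarrow> (nat \<Rightarrow> real) set"
  where "blurred_hull n Y r = {x \<in> topspace (Euclidean_space n).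
    \<forall>u. \<exists>y\<in>Y. dotE n (x - y) u \<le> r * nrmE n u}"

lemma blurred_hull_ball:
  assumes "y \<in> Y" "x \<in> topspace (Euclidean_space n)" "nrmE n (x - y) \<le> r"
  shows "x \<in> blurred_hull n Y r"
proof -
  have "dotE n (x - y) u \<le> r * nrmE n u" for u
    using dotE_le[of n "x - y" u] mult_right_mono[OF assms(3) nrmE_nonneg[of n u]] by linarith
  then show ?thesis using assms by (auto simp: blurred_hull_def)
qed

text \<open>For a fixed \<open>u\<close>, of the two witnesses the one with the larger inner product
  with \<open>u\<close> serves both points, hence also their convex combination.\<close>

lemma convex_blurred_hull: "convex (blurred_hull n Y r)"
proof (rule convexI)
  fix x z :: "nat \<Rightarrow> real" and a b :: real
  assume x: "x \<in> blurred_hull n Y r" and z: "z \<in> blurred_hull n Y r" and ab: "a \<ge> 0" "b \<ge> 0" "a + b = 1"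
  have "\<exists>y\<in>Y. dotE n (a *\<^sub>R x + b *\<^sub>R z - y) u \<le> r * nrmE n u" for u
  proof -
    obtain y y' where y: "y \<in> Y" "dotE n (x - y) u \<le> r * nrmE n u"
      and y': "y' \<in> Y" "dotE n (z - y') u \<le> r * nrmE n u"
      using x z unfolding blurred_hull_def by blast
    obtain w where w: "w \<in> Y" "dotE n y u \<le> dotE n w u" "dotE n y' u \<le> dotE n w u"
      using y(1) y'(1) by (metis linear order_refl)
    have "dotE n x u \<le> dotE n w u + r * nrmE n u" "dotE n z u \<le> dotE n w u + r * nrmE n u"
      using y(2) y'(2) w by (simp_all add: dotE_simps)
    then have "a * dotE n x u + b * dotE n z u \<le> a * (dotE n w u + r * nrmE n u) + b * (dotE n w u + r * nrmE n u)"
      using ab by (intro add_mono mult_left_mono) auto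
    also have "\<dots> = dotE n w u + r * nrmE n u"
      using ab(3) by (simp flip: distrib_right)
    finally show ?thesis using w(1) by (auto simp: dotE_simps intro!: bexI[of _ w])
  qed
  moreover have "a *\<^sub>R x + b *\<^sub>R z \<in> topspace (Euclidean_space n)"
    using x z by (auto simp: blurred_hull_def topspace_Euclidean_space)
  ultimately show "a *\<^sub>R x + b *\<^sub>R z \<in> blurred_hull n Y r" by (simp add: blurred_hull_def)
qed

section \<open>Topology and symmetry of the body\<close>

lemma continuous_on_dotE [continuous_intros]:
  fixes f g :: "'a::topological_space \<Rightarrow> nat \<Rightarrow> real"
  assumes "continuous_on S f" "continuous_on S g"
  shows "continuous_on S (\<lambda>x. dotE n (f x) (g x))"
  unfolding dotE_def
  by (intro continuous_on_sum continuous_on_mult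
    continuous_on_product_then_coordinatewise[OF assms(1)] continuous_on_product_then_coordinatewise[OF assms(2)])

lemma continuous_on_fun_diff_const:
  fixes f :: "'a::topological_space \<Rightarrow> nat \<Rightarrow> real"
  assumes "continuous_on S f"
  shows "continuous_on S (\<lambda>x. f x - y)"
  by (rule continuous_on_coordinatewise_then_product, unfold fun_diff_def)
    (rule continuous_on_diff[OF continuous_on_product_then_coordinatewise[OF assms] continuous_on_const])

lemma closed_Euclidean_space: "closed (topspace (Euclidean_space n))"
proof -
  have "topspace (Euclidean_space n) = (\<Inter>i\<in>{n..}. {x. x i = 0})"
    by (auto simp: topspace_Euclidean_space)
  moreover have "closed {x :: nat \<Rightarrow> real. x i = 0}" for i
    by (intro closed_Collect_eq continuous_on_const continuous_on_product_coordinates)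
  ultimately show ?thesis by auto
qed

text \<open>For each \<open>u\<close> the condition is a finite union of closed sets, and
  intersecting over all \<open>u\<close> keeps it closed.\<close>

lemma closed_blurred_hull:
  assumes "finite Y"
  shows "closed (blurred_hull n Y r)"
proof -
  have "blurred_hull n Y r = topspace (Euclidean_space n) \<inter>
      (\<Inter>u. \<Union>y\<in>Y. {x. dotE n (x - y) u \<le> r * nrmE n u})"
    by (auto simp: blurred_hull_def)
  moreover have "closed {x. dotE n (x - y) u \<le> r * nrmE n u}" for y u
    by (intro closed_Collect_le continuous_on_dotE continuous_on_fun_diff_const continuous_on_const
      continuous_on_id)
  ultimately show ?thesis using assms
    by (auto intro!: closed_Int closed_Euclidean_space closed_INT closed_UN)
qed

lemma borel_blurred_hull: "finite Y \<Longrightarrow> blurred_hull n Y r \<in> sets borel"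
  by (intro borel_closed closed_blurred_hull)

text \<open>Test the defining condition in the direction \<open>u = x\<close> and divide by the norm
  of \<open>x\<close>.\<close>

lemma blurred_hull_nrmE_le:
  assumes "x \<in> blurred_hull n Y r" "\<And>y. y \<in> Y \<Longrightarrow> nrmE n y \<le> R" "0 \<le> R + r"
  shows "nrmE n x \<le> R + r"
proof -
  obtain y where y: "y \<in> Y" "dotE n (x - y) x \<le> r * nrmE n x"
    using assms(1) unfolding blurred_hull_def by blast
  have "nrmE n x * nrmE n x = sqE n x" by (simp add: nrmE_def)
  also have "\<dots> \<le> dotE n y x + r * nrmE n x"
    using y(2) by (simp add: dotE_simps)
  also have "dotE n y x \<le> nrmE n y * nrmE n x" by (rule dotE_le)
  also have "nrmE n y * nrmE n x \<le> R * nrmE n x"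
    using assms(2)[OF y(1)] by (intro mult_right_mono) auto
  finally have "nrmE n x * nrmE n x \<le> (R + r) * nrmE n x" by (simp add: distrib_right)
  then show ?thesis
    using assms(3) nrmE_nonneg[of n x] by (cases "nrmE n x = 0") auto
qed

lemma coord_le_nrmE:
  assumes "i < n"
  shows "\<bar>x i\<bar> \<le> nrmE n x"
proof -
  have "(x i)\<^sup>2 \<le> sqE n x"
    unfolding sqE_eq using assms by (intro member_le_sum) auto
  then show ?thesis unfolding nrmE_def by (metis real_sqrt_abs real_sqrt_le_iff)
qed

text \<open>A closed subset of a product of compact intervals, compact by Tychonoff. The coordinates
  from \<open>n\<close> on are 0 and stay in the interval because \<open>R + r\<close> is
  nonnegative.\<close>

lemma compact_blurred_hull:
  assumes "finite Y" "\<And>y. y \<in> Y \<Longrightarrow> nrmE n y \<le> R" "0 \<le> R + r"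
  shows "compact (blurred_hull n Y r)"
proof -
  let ?B = "Pi\<^sub>E UNIV (\<lambda>_::nat. {- (R + r)..R + r})"
  have "compactin (product_topology (\<lambda>_. euclidean) UNIV) ?B"
    by (simp add: compactin_PiE)
  then have "compact ?B" by (simp add: euclidean_product_topology)
  moreover have "blurred_hull n Y r \<subseteq> ?B"
  proof
    fix x assume x: "x \<in> blurred_hull n Y r"
    have "\<bar>x i\<bar> \<le> R + r" for i
    proof (cases "i < n")
      case True
      show ?thesis
        using coord_le_nrmE[OF True, of x] blurred_hull_nrmE_le[OF x assms(2,3)] by linarith
    next
      case False
      then have "x i = 0" using x by (simp add: blurred_hull_def topspace_Euclidean_space)
      then show ?thesis using assms(3) by simp
    qed
    then have "- (R + r) \<le> x i" "x i \<le> R + r" for i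
      using abs_le_D1 abs_le_D2 minus_le_iff by blast+
    then show "x \<in> ?B" by (simp add: PiE_UNIV_domain Pi_iff)
  qed
  ultimately show ?thesis
    using closed_blurred_hull[OF assms(1), of n r] compact_Int_closed[of ?B "blurred_hull n Y r"]
    by (simp add: inf.absorb2)
qed

lemma Euclidean_space_subtopology: "Euclidean_space n = subtopology euclidean (topspace (Euclidean_space n))"
  unfolding Euclidean_space_def by (simp add: euclidean_product_topology)

lemma convex_body_blurred_hull:
  assumes "finite Y" "Y \<noteq> {}" "Y \<subseteq> topspace (Euclidean_space n)" "r > 0"
  shows "convex_body n (blurred_hull n Y r)"
proof -
  obtain R where R: "\<And>y. y \<in> Y \<Longrightarrow> nrmE n y \<le> R" "R \<ge> 0"
  proof
    show "nrmE n y \<le> (\<Sum>y\<in>Y. nrmE n y)" if "y \<in> Y" for y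
      using assms(1) that by (intro member_le_sum) auto
    show "(\<Sum>y\<in>Y. nrmE n y) \<ge> 0" by (simp add: sum_nonneg)
  qed
  have "compact (blurred_hull n Y r)"
    using compact_blurred_hull[OF assms(1) R(1)] R(2) assms(4) by simp
  moreover have "blurred_hull n Y r \<subseteq> topspace (Euclidean_space n)" by (auto simp: blurred_hull_def)
  ultimately have "compactin (Euclidean_space n) (blurred_hull n Y r)"
    by (subst Euclidean_space_subtopology) (simp add: compactin_subtopology)
  moreover have "Euclidean_space n interior_of blurred_hull n Y r \<noteq> {}"
  proof -
    obtain y where y: "y \<in> Y" using assms(2) by blast
    let ?U = "{x. nrmE n (x - y) < r}"
    have "open ?U"
      unfolding nrmE_def
      by (intro open_Collect_less continuous_on_real_sqrt continuous_on_dotE continuous_on_fun_diff_const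
        continuous_on_const continuous_on_id)
    then have "openin (Euclidean_space n) (?U \<inter> topspace (Euclidean_space n))"
      by (subst Euclidean_space_subtopology) (auto simp: openin_subtopology)
    moreover have "?U \<inter> topspace (Euclidean_space n) \<subseteq> blurred_hull n Y r"
      using blurred_hull_ball[OF y] by auto
    ultimately have "?U \<inter> topspace (Euclidean_space n) \<subseteq> Euclidean_space n interior_of blurred_hull n Y r"
      by (simp add: interior_of_maximal)
    moreover have "y \<in> ?U \<inter> topspace (Euclidean_space n)"
      using y assms by (auto simp: nrmE_def)
    ultimately show ?thesis by blast
  qed
  ultimately show ?thesis by (simp add: convex_body_def convex_blurred_hull)
qed

text \<open>For \<open>- x\<close> and \<open>u\<close>, negate the witness belonging to
  \<open>x\<close> and \<open>- u\<close>.\<close>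

lemma uminus_blurred_hull:
  assumes "uminus ` Y = Y"
  shows "uminus ` blurred_hull n Y r = blurred_hull n Y r"
proof -
  have *: "- x \<in> blurred_hull n Y r" if x: "x \<in> blurred_hull n Y r" for x
  proof -
    have "\<exists>y\<in>Y. dotE n (- x - y) u \<le> r * nrmE n u" for u
    proof -
      obtain y where y: "y \<in> Y" "dotE n (x - y) (- u) \<le> r * nrmE n (- u)"
        using x unfolding blurred_hull_def by blast
      have "dotE n (- x - (- y)) u = dotE n (x - y) (- u)"
        by (simp add: dotE_simps)
      moreover have "- y \<in> Y" using y(1) assms by blast
      ultimately show ?thesis using y(2) by (intro bexI[of _ "- y"]) auto
    qed
    then show ?thesis using x by (auto simp: blurred_hull_def topspace_Euclidean_space)
  qed
  show ?thesis
  proof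
    show "uminus ` blurred_hull n Y r \<subseteq> blurred_hull n Y r" using * by blast
    show "blurred_hull n Y r \<subseteq> uminus ` blurred_hull n Y r"
    proof
      fix x assume "x \<in> blurred_hull n Y r"
      then show "x \<in> uminus ` blurred_hull n Y r" using * by (intro image_eqI[of _ _ "- x"]) auto
    qed
  qed
qed

text \<open>Phrased as a preimage to fit \<open>emeasure_lborelE_scaleR\<close>.\<close>

lemma blurred_hull_scaleR:
  assumes "c > 0"
  shows "(\<lambda>x. c *\<^sub>R x) -` blurred_hull n ((\<lambda>x. c *\<^sub>R x) ` Y) (c * r) = blurred_hull n Y r"
proof -
  have "dotE n (c *\<^sub>R x - c *\<^sub>R y) u \<le> c * r * nrmE n u \<longleftrightarrow> dotE n (x - y) u \<le> r * nrmE n u" for x y u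
  proof -
    have "dotE n (c *\<^sub>R x - c *\<^sub>R y) u = c * dotE n (x - y) u"
      by (simp add: dotE_simps right_diff_distrib)
    then show ?thesis using assms by (simp add: mult.assoc)
  qed
  then show ?thesis using assms
    by (auto simp: blurred_hull_def topspace_Euclidean_space)
qed

text \<open>Maurey's empirical method, derandomised: a greedy choice of the \<open>y i\<close> replaces sampling from
  a convex combination of \<open>Y\<close> close to \<open>x\<close>.\<close>

lemma blurred_hull_approx:
  fixes m :: nat and r :: real
  assumes x: "x \<in> blurred_hull n Y r" and R: "\<And>y. y \<in> Y \<Longrightarrow> nrmE n y \<le> R" and "0 \<le> R" "0 \<le> r"
  shows "\<exists>y. (\<forall>i<m. y i \<in> Y) \<and> nrmE n (\<Sum>i<m. x - y i) \<le> m * r + (2 * R + r) * sqrt m"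
proof (induction m)
  case 0
  show ?case by (simp add: nrmE_def sqE_eq)
next
  case (Suc m)
  \<comment> \<open>Bounds the length of each \<open>x - y i\<close>: the body lies within
    \<open>R + r\<close> of the origin and \<open>Y\<close> within \<open>R\<close>.\<close>
  let ?D = "2 * R + r"
  have D: "?D \<ge> 0" using assms by simp
  obtain y where y: "\<forall>i<m. y i \<in> Y" "nrmE n (\<Sum>i<m. x - y i) \<le> m * r + ?D * sqrt m"
    using Suc by blast
  define z where "z = (\<Sum>i<m. x - y i)"
  \<comment> \<open>The greedy choice: the defining condition in the direction of the current sum
    \<open>z\<close> makes the cross term at most \<open>r * nrmE n z\<close>.\<close>
  obtain w where w: "w \<in> Y" "dotE n (x - w) z \<le> r * nrmE n z"
    using x unfolding blurred_hull_def by blast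
  have "nrmE n (x - w) \<le> nrmE n x + nrmE n w"
    using nrmE_triangle[of n x "- w"] by simp
  also have "\<dots> \<le> ?D" using blurred_hull_nrmE_le[OF x R] R[OF w(1)] assms by simp
  finally have xw: "nrmE n (x - w) \<le> ?D" .
  have nz: "nrmE n z \<le> m * r + ?D * sqrt m" using y(2) by (simp add: z_def)
  have "(nrmE n (z + (x - w)))\<^sup>2 = (nrmE n z)\<^sup>2 + 2 * dotE n (x - w) z + (nrmE n (x - w))\<^sup>2"
    unfolding nrmE_sq dotE_add_left dotE_add_right dotE_commute[of n z "x - w"] by simp
  also have "\<dots> \<le> (nrmE n z)\<^sup>2 + 2 * (r * nrmE n z) + ?D\<^sup>2"
    using w(2) xw by (intro add_mono power_mono) auto
  also have "\<dots> \<le> (nrmE n z + r)\<^sup>2 + ?D\<^sup>2"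
    by (simp add: power2_sum)
  also have "\<dots> \<le> (Suc m * r + ?D * sqrt m)\<^sup>2 + ?D\<^sup>2"
  proof -
    have "nrmE n z + r \<le> Suc m * r + ?D * sqrt m"
      using nz by (simp add: distrib_right)
    then show ?thesis using assms(4) by (intro add_right_mono power_mono) auto
  qed
  \<comment> \<open>The new square \<open>?D\<^sup>2\<close> is exactly what replacing
    \<open>sqrt m\<close> by \<open>sqrt (Suc m)\<close> gains.\<close>
  also have "\<dots> \<le> (Suc m * r + ?D * sqrt (Suc m))\<^sup>2"
  proof -
    have "(?D * sqrt (Suc m))\<^sup>2 = (?D * sqrt m)\<^sup>2 + ?D\<^sup>2"
      by (simp add: power_mult_distrib distrib_left)
    moreover have "(Suc m * r) * (?D * sqrt m) \<le> (Suc m * r) * (?D * sqrt (Suc m))"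
      using D assms by (intro mult_left_mono) auto
    ultimately show ?thesis by (simp add: power2_sum)
  qed
  finally have "nrmE n (z + (x - w)) \<le> Suc m * r + ?D * sqrt (Suc m)"
    by (rule power2_le_imp_le) (use assms in auto)
  then have "(\<forall>i<Suc m. (y(m := w)) i \<in> Y) \<and>
      nrmE n (\<Sum>i<Suc m. x - (y(m := w)) i) \<le> Suc m * r + ?D * sqrt (Suc m)"
    using y(1) w(1) by (auto simp: less_Suc_eq z_def)
  then show ?case by blast
qed

text \<open>The averages of \<open>m\<close>-tuples from \<open>Y\<close> come within \<rho> of
  every point of the body. Instead of volumes of balls, the indicator of a ball is bounded by
  \<open>exp (\<rho>\<^sup>2 / 2)\<close> times a standard Gaussian, whose integral is
  explicit.\<close>

lemma emeasure_blurred_hull_le: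
  assumes fin: "finite Y" and R: "\<And>y. y \<in> Y \<Longrightarrow> nrmE n y \<le> R" and "0 \<le> R" "0 \<le> r" "m > 0"
  defines "\<rho> \<equiv> r + (2 * R + r) / sqrt m"
  shows "emeasure (lborelE n) (blurred_hull n Y r) \<le> ennreal (card Y ^ m * exp (\<rho>\<^sup>2 / 2) * sqrt (2 * pi) ^ n)"
proof -
  let ?T = "{..<m} \<rightarrow>\<^sub>E Y"
  have finT: "finite ?T" using fin by (intro finite_PiE) auto
  define a where "a f = (1 / real m) *\<^sub>R (\<Sum>i<m. f i)" for f :: "nat \<Rightarrow> nat \<Rightarrow> real"
  have near: "\<exists>f\<in>?T. sqE n (x - a f) \<le> \<rho>\<^sup>2" if x: "x \<in> blurred_hull n Y r" for x
  proof -
    obtain y where y: "\<forall>i<m. y i \<in> Y" "nrmE n (\<Sum>i<m. x - y i) \<le> m * r + (2 * R + r) * sqrt m"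
      using blurred_hull_approx[OF x R assms(3,4)] by blast
    let ?f = "\<lambda>i\<in>{..<m}. y i"
    have "x - a ?f = (1 / real m) *\<^sub>R (\<Sum>i<m. x - y i)"
      using assms(5) by (intro ext) (simp add: a_def sum_fun_apply sum_subtractf field_simps)
    then have "nrmE n (x - a ?f) = nrmE n (\<Sum>i<m. x - y i) / real m"
      by (simp add: nrmE_scaleR)
    also have "\<dots> \<le> (m * r + (2 * R + r) * sqrt m) / real m"
      using y(2) by (intro divide_right_mono) auto
    also have "\<dots> = \<rho>"
    proof -
      have "sqrt m / m = 1 / sqrt m" using assms(5) by (simp add: divide_simps)
      moreover have "(m * r + (2 * R + r) * sqrt m) / m = r + (2 * R + r) * (sqrt m / m)"
        using assms(5) by (simp add: add_divide_distrib)
      ultimately show ?thesis by (simp add: \<rho>_def)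
    qed
    finally have "(nrmE n (x - a ?f))\<^sup>2 \<le> \<rho>\<^sup>2" by (intro power_mono) auto
    moreover have "?f \<in> ?T" using y(1) by auto
    ultimately show ?thesis unfolding nrmE_sq by blast
  qed
  have "emeasure (lborelE n) (blurred_hull n Y r) = (\<integral>\<^sup>+x. indicator (blurred_hull n Y r) x \<partial>lborelE n)"
    using borel_blurred_hull[OF fin] by simp
  also have "\<dots> \<le> (\<integral>\<^sup>+x. (\<Sum>f\<in>?T. ennreal (exp (\<rho>\<^sup>2 / 2)) * ennreal (exp (- sqE n (x - a f) / (2 * 1)))) \<partial>lborelE n)"
  proof (rule nn_integral_mono)
    fix x
    show "indicator (blurred_hull n Y r) x \<le>
      (\<Sum>f\<in>?T. ennreal (exp (\<rho>\<^sup>2 / 2)) * ennreal (exp (- sqE n (x - a f) / (2 * 1))))"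
    proof (cases "x \<in> blurred_hull n Y r")
      case True
      obtain f where f: "f \<in> ?T" "sqE n (x - a f) \<le> \<rho>\<^sup>2" using near[OF True] by blast
      have "1 \<le> exp (\<rho>\<^sup>2 / 2) * exp (- sqE n (x - a f) / (2 * 1))"
        unfolding exp_add[symmetric] using f(2) by simp
      then have "1 \<le> ennreal (exp (\<rho>\<^sup>2 / 2) * exp (- sqE n (x - a f) / (2 * 1)))"
        by (simp only: ennreal_ge_1)
      also have "\<dots> = ennreal (exp (\<rho>\<^sup>2 / 2)) * ennreal (exp (- sqE n (x - a f) / (2 * 1)))"
        by (rule ennreal_mult) auto
      also have "\<dots> \<le> (\<Sum>f\<in>?T. ennreal (exp (\<rho>\<^sup>2 / 2)) * ennreal (exp (- sqE n (x - a f) / (2 * 1))))"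
        using finT f(1) by (intro member_le_sum) auto
      finally show ?thesis using True by simp
    qed simp
  qed
  also have "\<dots> = (\<Sum>f\<in>?T. ennreal (exp (\<rho>\<^sup>2 / 2)) *
      (\<integral>\<^sup>+x. ennreal (exp (- sqE n (x - a f) / (2 * 1))) \<partial>lborelE n))"
    by (subst nn_integral_sum) (measurable, subst nn_integral_cmult, measurable)
  also have "\<dots> = (\<Sum>f\<in>?T. ennreal (exp (\<rho>\<^sup>2 / 2)) * ennreal (sqrt (2 * pi * 1) ^ n))"
    by (subst nn_integral_gaussianE) auto
  also have "\<dots> = ennreal (real (card ?T) * (exp (\<rho>\<^sup>2 / 2) * sqrt (2 * pi) ^ n))"
    by (simp add: ennreal_mult ennreal_of_nat_eq_real_of_nat)
  also have "real (card ?T) = real (card Y ^ m)" by (simp add: card_PiE)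
  finally show ?thesis by (simp add: mult.assoc)
qed

text \<open>A product measure is determined by its values on boxes, so the one-dimensional scaling
  rule in each coordinate suffices. Extension by zero commutes with scaling, which carries the
  result over to \<open>lborelE\<close>.\<close>

lemma emeasure_lborelE_scaleR:
  assumes c: "c > 0" and A: "A \<in> sets borel"
  shows "emeasure (lborelE n) A = ennreal (c ^ n) * emeasure (lborelE n) ((\<lambda>x. c *\<^sub>R x) -` A)"
proof -
  interpret product_sigma_finite "\<lambda>_::nat. lborel :: real measure" ..
  let ?P = "Pi\<^sub>M {..<n} (\<lambda>_. lborel :: real measure)"
  let ?T = "\<lambda>x. \<lambda>i\<in>{..<n}. c * x i :: real"
  let ?e = "\<lambda>x (i::nat). if i < n then x i else (0::real)"
  have T [measurable]: "?T \<in> measurable ?P ?P"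
    by (intro measurable_restrict) measurable
  have one: "emeasure lborel B = ennreal c * emeasure lborel ((\<lambda>t. c * t) -` B)"
    if "B \<in> sets borel" for B :: "real set"
  proof -
    have "emeasure lborel B = emeasure (density (distr lborel borel (\<lambda>t. 0 + c * t)) (\<lambda>_. \<bar>c\<bar>)) B"
      using lborel_real_affine[of c 0] c by simp
    also have "\<dots> = ennreal c * emeasure (distr lborel borel (\<lambda>t. 0 + c * t)) B"
      using that c by (subst emeasure_density) (auto simp: nn_integral_cmult_indicator)
    also have "emeasure (distr lborel borel (\<lambda>t. 0 + c * t)) B = emeasure lborel ((\<lambda>t. c * t) -` B)"
      using that by (subst emeasure_distr) auto
    finally show ?thesis .
  qed
  have "density (distr ?P ?P ?T) (\<lambda>_. ennreal (c ^ n)) = ?P"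
  proof (rule PiM_eqI)
    fix B :: "nat \<Rightarrow> real set" assume B: "\<And>i. i \<in> {..<n} \<Longrightarrow> B i \<in> sets lborel"
    have m: "Pi\<^sub>E {..<n} B \<in> sets ?P" using B by (intro sets_PiM_I_finite) auto
    have v: "?T -` Pi\<^sub>E {..<n} B \<inter> space ?P = Pi\<^sub>E {..<n} (\<lambda>i. (\<lambda>t. c * t) -` B i)"
      by (auto simp: space_PiM PiE_iff)
    have "emeasure (density (distr ?P ?P ?T) (\<lambda>_. ennreal (c ^ n))) (Pi\<^sub>E {..<n} B) =
        ennreal (c ^ n) * emeasure ?P (?T -` Pi\<^sub>E {..<n} B \<inter> space ?P)"
      using m T by (subst emeasure_density) (simp_all add: nn_integral_cmult_indicator emeasure_distr)
    also have "\<dots> = ennreal (c ^ n) * (\<Prod>i<n. emeasure lborel ((\<lambda>t. c * t) -` B i))"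
      unfolding v using B by (subst emeasure_PiM) (auto intro!: measurable_sets_borel[of "\<lambda>t. c * t" borel])
    also have "\<dots> = (\<Prod>i<n. ennreal c * emeasure lborel ((\<lambda>t. c * t) -` B i))"
      using c by (simp add: prod.distrib ennreal_power)
    also have "\<dots> = (\<Prod>i<n. emeasure lborel (B i))"
      using one B by (intro prod.cong) auto
    finally show "emeasure (density (distr ?P ?P ?T) (\<lambda>_. ennreal (c ^ n))) (Pi\<^sub>E {..<n} B) =
      (\<Prod>i<n. emeasure lborel (B i))" .
  qed simp_all
  then have "emeasure ?P (?e -` A \<inter> space ?P) =
      emeasure (density (distr ?P ?P ?T) (\<lambda>_. ennreal (c ^ n))) (?e -` A \<inter> space ?P)"
    by simp
  also have "\<dots> = ennreal (c ^ n) * emeasure ?P (?T -` (?e -` A \<inter> space ?P) \<inter> space ?P)"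
    using measurable_sets[OF measurable_extend_zero A] T
    by (subst emeasure_density) (simp_all add: nn_integral_cmult_indicator emeasure_distr)
  also have "?T -` (?e -` A \<inter> space ?P) \<inter> space ?P = ?e -` ((\<lambda>x. c *\<^sub>R x) -` A) \<inter> space ?P"
  proof -
    have "?e (?T x) = c *\<^sub>R ?e x" for x by (auto simp: fun_eq_iff)
    then show ?thesis by (auto simp: space_PiM)
  qed
  finally have "emeasure ?P (?e -` A \<inter> space ?P) =
    ennreal (c ^ n) * emeasure ?P (?e -` ((\<lambda>x. c *\<^sub>R x) -` A) \<inter> space ?P)" .
  moreover have "(\<lambda>x::nat \<Rightarrow> real. c *\<^sub>R x) \<in> borel_measurable borel"
    by (rule measurable_coordinatewise_then_product) simp
  then have "(\<lambda>x. c *\<^sub>R x) -` A \<in> sets borel" using A by (rule measurable_sets_borel)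
  ultimately show ?thesis
    unfolding lborelE_def using A
    by (simp add: emeasure_distr[OF measurable_extend_zero])
qed

section \<open>The density and its sections\<close>

text \<open>The push-forward defining \<open>lborelE\<close> reaches only functions vanishing from
  \<open>n\<close> on. This matters because balls lie in the body only after intersection with
  \<open>Euclidean_space n\<close>.\<close>

lemma AE_lborelE_Euclidean_space: "AE x in lborelE n. x \<in> topspace (Euclidean_space n)"
  unfolding lborelE_def
  by (subst AE_distr_iff[OF measurable_extend_zero])
    (auto simp: topspace_Euclidean_space intro!: sets.sets_Collect borel_closed
      closed_Euclidean_space[unfolded topspace_Euclidean_space])

text \<open>The radius is that of \<open>gaussian_ball\<close> for variance
  \<open>c\<^sup>2\<close>, and the ball of this radius around a point of \<open>Y\<close> lies in
  the body up to a null set.\<close>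

lemma gaussian_mass_blurred_hull:
  assumes "c > 0" "n \<ge> 2" "finite Y" "y \<in> Y" "r = 2 * c * sqrt n"
  shows "ennreal (2/3 * sqrt (2 * pi * c\<^sup>2) ^ n) \<le>
    (\<integral>\<^sup>+x. ennreal (exp (- sqE n (x - y) / (2 * c\<^sup>2))) * indicator (blurred_hull n Y r) x \<partial>lborelE n)"
proof -
  have "ennreal (2/3 * sqrt (2 * pi * c\<^sup>2) ^ n) \<le> (\<integral>\<^sup>+x. ennreal (exp (- sqE n (x - y) / (2 * c\<^sup>2))) *
      indicator {x. sqE n (x - y) \<le> 4 * c\<^sup>2 * n} x \<partial>lborelE n)"
    using assms by (intro gaussian_ball) auto
  also have "\<dots> \<le> (\<integral>\<^sup>+x. ennreal (exp (- sqE n (x - y) / (2 * c\<^sup>2))) * indicator (blurred_hull n Y r) x \<partial>lborelE n)"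
  proof (rule nn_integral_mono_AE, rule AE_mp[OF AE_lborelE_Euclidean_space], rule AE_I2, rule impI)
    fix x :: "nat \<Rightarrow> real" assume x: "x \<in> topspace (Euclidean_space n)"
    have "x \<in> blurred_hull n Y r" if "sqE n (x - y) \<le> 4 * c\<^sup>2 * n"
    proof (rule blurred_hull_ball[OF assms(4) x])
      have "nrmE n (x - y) \<le> sqrt (4 * c\<^sup>2 * n)"
        unfolding nrmE_def using that by simp
      also have "\<dots> = r" using assms by (simp add: real_sqrt_mult)
      finally show "nrmE n (x - y) \<le> r" .
    qed
    then show "ennreal (exp (- sqE n (x - y) / (2 * c\<^sup>2))) * indicator {x. sqE n (x - y) \<le> 4 * c\<^sup>2 * n} x
      \<le> ennreal (exp (- sqE n (x - y) / (2 * c\<^sup>2))) * indicator (blurred_hull n Y r) x"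
      by (auto simp: indicator_def)
  qed
  finally show ?thesis .
qed

lemma sq_dist_span_scaleR: "sq_dist_span n d b (c *\<^sub>R y) = c\<^sup>2 * sq_dist_span n d b y"
  by (simp add: sq_dist_span_def dotE_simps power2_eq_square sum_distrib_left algebra_simps)

lemma sq_dist_span_minus [simp]: "sq_dist_span n d b (- y) = sq_dist_span n d b y"
  by (simp add: sq_dist_span_def)

text \<open>Rescaling by \<open>c\<close> makes the volume 1 and turns the standard Gaussians into
  ones of variance \<open>c\<^sup>2\<close>. Truncation keeps 2/3 of every Gaussian, whence the
  factor 3/2. A section lacks \<open>k\<close> of the \<open>n\<close> factors
  \<open>sqrt (2 * pi * c\<^sup>2)\<close>, each of which is at least \<open>1 / V\<close>.\<close>

lemma density_of_points:
  fixes n k N :: nat and y :: "nat \<Rightarrow> nat \<Rightarrow> real" and V Q :: real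
  assumes n: "n \<ge> 2" and k: "k \<le> n" and N: "N > 0" and V: "V > 0"
    and yE: "\<And>i. i < N \<Longrightarrow> y i \<in> topspace (Euclidean_space n)"
  defines "Y \<equiv> y ` {..<N} \<union> uminus ` y ` {..<N}"
  assumes vol: "emeasure (lborelE n) (blurred_hull n Y (2 * sqrt n)) \<le> ennreal (V ^ n)"
    and avg: "\<And>b. orthonormal_family n (n - k) b \<Longrightarrow> (\<Sum>i<N. exp (- sq_dist_span n (n - k) b (y i) / 2)) \<le> Q * N"
  shows "\<exists>K f. convex_body n K \<and> uminus ` K = K \<and> measure (lborelE n) K = 1 \<and>
    even_continuous_density n K f \<and>
    (\<forall>F. subspace F \<and> F \<subseteq> topspace (Euclidean_space n) \<and> dim F = n - k \<longrightarrow>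
      integral\<^sup>L (lborel_on_subspace n F) f \<le> 3/2 * V ^ k * Q)"
proof -
  have finY: "finite Y" and neY: "Y \<noteq> {}" using N by (auto simp: Y_def)
  have symY: "uminus ` Y = Y" by (auto simp: Y_def image_Un image_image)
  have YE: "Y \<subseteq> topspace (Euclidean_space n)"
    using yE by (auto simp: Y_def topspace_Euclidean_space)
  define K0 where "K0 = blurred_hull n Y (2 * sqrt n)"
  define v where "v = measure (lborelE n) K0"
  have K0b: "K0 \<in> sets borel" unfolding K0_def by (rule borel_blurred_hull[OF finY])
  have "emeasure (lborelE n) K0 < \<infinity>" using vol by (simp add: K0_def order_le_less_trans)
  then have ev: "emeasure (lborelE n) K0 = ennreal v"
    unfolding v_def by (simp add: emeasure_eq_ennreal_measure less_top)
  \<comment> \<open>The volume is at least the Gaussian mass inside the body, since the unnormalised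
    Gaussian is at most 1.\<close>
  have v0: "v > 0"
  proof -
    have y0: "y 0 \<in> Y" using N by (auto simp: Y_def)
    have "ennreal (2/3 * sqrt (2 * pi * 1\<^sup>2) ^ n) \<le>
        (\<integral>\<^sup>+x. ennreal (exp (- sqE n (x - y 0) / (2 * 1\<^sup>2))) * indicator K0 x \<partial>lborelE n)"
      unfolding K0_def by (rule gaussian_mass_blurred_hull[OF _ n finY y0]) auto
    also have "\<dots> \<le> (\<integral>\<^sup>+x. indicator K0 x \<partial>lborelE n)"
      by (intro nn_integral_mono) (auto simp: indicator_def)
    also have "\<dots> = ennreal v" using K0b ev by simp
    finally have "2/3 * sqrt (2 * pi * 1\<^sup>2) ^ n \<le> v"
      by (subst (asm) ennreal_le_iff) (auto simp: v_def)
    moreover have "2/3 * sqrt (2 * pi * 1\<^sup>2) ^ n > 0" by simp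
    ultimately show ?thesis by linarith
  qed
  define c where "c = 1 / root n v"
  have c: "c > 0" using v0 n by (simp add: c_def)
  have cn: "c ^ n = 1 / v" using v0 n by (simp add: c_def power_divide)
  have cV: "1 / c \<le> V"
  proof -
    have "v \<le> V ^ n" using vol V unfolding K0_def[symmetric] ev by (subst (asm) ennreal_le_iff) auto
    then have "root n v \<le> root n (V ^ n)" using n by simp
    then show ?thesis using n V by (simp add: c_def real_root_power_cancel)
  qed
  let ?cY = "(\<lambda>x. c *\<^sub>R x) ` Y"
  define r where "r = c * (2 * sqrt n)"
  define K where "K = blurred_hull n ?cY r"
  have finc: "finite ?cY" using finY by simp
  have symc: "uminus ` ?cY = ?cY"
  proof -
    have "uminus ` ?cY = (\<lambda>x. c *\<^sub>R x) ` (uminus ` Y)" by (simp add: image_image)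
    then show ?thesis using symY by simp
  qed
  have Kb [measurable]: "K \<in> sets borel" unfolding K_def by (rule borel_blurred_hull[OF finc])
  have cb: "convex_body n K"
    unfolding K_def using finc neY YE c n
    by (intro convex_body_blurred_hull) (auto simp: topspace_Euclidean_space r_def)
  have symK: "uminus ` K = K" unfolding K_def by (rule uminus_blurred_hull[OF symc])
  have KE: "K \<subseteq> topspace (Euclidean_space n)" by (auto simp: K_def blurred_hull_def)
  have "emeasure (lborelE n) K = ennreal (c ^ n) * emeasure (lborelE n) K0"
    using emeasure_lborelE_scaleR[OF c Kb, of n] blurred_hull_scaleR[OF c, of n Y "2 * sqrt n"]
    by (simp add: K_def r_def K0_def)
  also have "\<dots> = 1" unfolding ev cn using v0 by (simp flip: ennreal_mult)
  finally have mK: "measure (lborelE n) K = 1" by (simp add: measure_def)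

  let ?G = "sqrt (2 * pi * c\<^sup>2)"
  have G: "?G > 0" using c by simp
  define g where "g z x = exp (- sqE n (x - z) / (2 * c\<^sup>2))" for z x :: "nat \<Rightarrow> real"
  have g_meas [measurable]: "g z \<in> borel_measurable borel" for z
    unfolding g_def by measurable
  have g0: "g z x \<ge> 0" for z x by (simp add: g_def)
  \<comment> \<open>Centres come in opposite pairs, which makes \<open>p\<close> even.\<close>
  define p where "p x = (\<Sum>i<N. g (c *\<^sub>R y i) x + g (- (c *\<^sub>R y i)) x)" for x
  have p_meas [measurable]: "p \<in> borel_measurable borel" unfolding p_def by measurable
  have p0: "p x \<ge> 0" for x unfolding p_def by (intro sum_nonneg) (simp add: g0)
  define Z where "Z = enn2real (\<integral>\<^sup>+x. ennreal (p x * indicator K x) \<partial>lborelE n)"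
  \<comment> \<open>The factor \<open>e\<close> will be the indicator of \<open>K\<close> for the
    normalisation and 1 for the sections.\<close>
  have sum_p: "ennreal (p x * e) = (\<Sum>i<N. ennreal (g (c *\<^sub>R y i) x * e) + ennreal (g (- (c *\<^sub>R y i)) x * e))"
    if "e \<ge> 0" for x e
    using that g0 unfolding p_def
    by (simp add: sum_distrib_right distrib_right sum_ennreal flip: ennreal_plus)
  have Z_low: "4/3 * N * ?G ^ n \<le> Z" and Z_fin: "(\<integral>\<^sup>+x. ennreal (p x * indicator K x) \<partial>lborelE n) = ennreal Z"
  proof -
    let ?I = "\<integral>\<^sup>+x. ennreal (p x * indicator K x) \<partial>lborelE n"
    have I: "?I = (\<Sum>i<N. (\<integral>\<^sup>+x. ennreal (g (c *\<^sub>R y i) x * indicator K x) \<partial>lborelE n) +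
        (\<integral>\<^sup>+x. ennreal (g (- (c *\<^sub>R y i)) x * indicator K x) \<partial>lborelE n))"
      by (simp add: sum_p nn_integral_sum nn_integral_add)
    have low: "ennreal (2/3 * ?G ^ n) \<le> (\<integral>\<^sup>+x. ennreal (g z x * indicator K x) \<partial>lborelE n)" if "z \<in> ?cY" for z
      using gaussian_mass_blurred_hull[OF c n finc that, of r]
      by (simp add: K_def r_def g_def ennreal_mult' ennreal_indicator[symmetric] mult_ac)
    \<comment> \<open>The upper bound makes the integral finite, so that \<open>enn2real\<close> in
      the definition of \<open>Z\<close> returns its true value.\<close>
    have up: "(\<integral>\<^sup>+x. ennreal (g z x * indicator K x) \<partial>lborelE n) \<le> ennreal (?G ^ n)" for z
    proof -
      have "(\<integral>\<^sup>+x. ennreal (g z x * indicator K x) \<partial>lborelE n) \<le> (\<integral>\<^sup>+x. ennreal (g z x) \<partial>lborelE n)"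
        by (intro nn_integral_mono ennreal_leI) (auto simp: indicator_def g0)
      also have "\<dots> = ennreal (?G ^ n)"
        unfolding g_def using c by (intro nn_integral_gaussianE) simp
      finally show ?thesis .
    qed
    have mem: "c *\<^sub>R y i \<in> ?cY" "- (c *\<^sub>R y i) \<in> ?cY" if "i < N" for i
    proof -
      show "c *\<^sub>R y i \<in> ?cY" using that by (auto simp: Y_def)
      then show "- (c *\<^sub>R y i) \<in> ?cY" using symc by blast
    qed
    have "?I \<le> (\<Sum>i<N. ennreal (?G ^ n) + ennreal (?G ^ n))"
      unfolding I by (intro sum_mono add_mono up)
    also have "\<dots> < \<infinity>" by (simp add: ennreal_mult_less_top less_top[symmetric] ennreal_mult_eq_top_iff)
    finally have fin: "?I < \<infinity>" .
    then show "?I = ennreal Z" by (simp add: Z_def less_top)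
    have "ennreal (4/3 * N * ?G ^ n) = (\<Sum>i<N. ennreal (2/3 * ?G ^ n) + ennreal (2/3 * ?G ^ n))"
      using G by (simp add: ennreal_of_nat_eq_real_of_nat mult_ac flip: ennreal_plus ennreal_mult)
    also have "\<dots> \<le> ?I"
      unfolding I using mem by (intro sum_mono add_mono low) auto
    finally show "4/3 * N * ?G ^ n \<le> Z"
      unfolding \<open>?I = ennreal Z\<close> by (subst (asm) ennreal_le_iff) (auto simp: Z_def)
  qed
  have Z: "Z > 0"
  proof -
    have "4/3 * N * ?G ^ n > 0" using N G by simp
    then show ?thesis using Z_low by linarith
  qed
  define f where "f x = p x * indicator K x / Z" for x
  have f_meas [measurable]: "f \<in> borel_measurable borel" unfolding f_def by measurable
  have f0: "f x \<ge> 0" for x using p0 Z by (simp add: f_def)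
  have "even_continuous_density n K f"
    unfolding even_continuous_density_def
  proof (intro conjI allI impI)
    have "subtopology (Euclidean_space n) K = subtopology euclidean K"
      using KE by (subst Euclidean_space_subtopology) (simp add: subtopology_subtopology inf.absorb2)
    moreover have "continuous_on K f"
    proof -
      have "continuous_on K (\<lambda>x. p x / Z)"
        unfolding p_def g_def using Z c
        by (intro continuous_on_divide continuous_on_sum continuous_on_add continuous_on_exp
          continuous_on_minus continuous_on_dotE continuous_on_fun_diff_const continuous_on_const
          continuous_on_id) auto
      then show ?thesis by (rule continuous_on_eq) (simp add: f_def)
    qed
    ultimately show "continuous_map (subtopology (Euclidean_space n) K) euclideanreal f" by simp
    show "f x \<ge> 0" for x by (rule f0)
    show "f (- x) = f x" for x
    proof -
      have "g (- z) (- x) = g z x" for z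
      proof -
        have "- x - (- z) = - (x - z)" by simp
        then show ?thesis by (simp only: g_def dotE_minus_left dotE_minus_right minus_minus)
      qed
      \<comment> \<open>Negating the argument swaps the two Gaussians of each pair.\<close>
      from this[of "_"] this[of "- _"] have "p (- x) = p x"
        unfolding p_def by (intro sum.cong refl) (metis add.commute minus_minus)
      moreover have "- x \<in> K \<longleftrightarrow> x \<in> K" using symK by (metis image_eqI minus_minus)
      ultimately show ?thesis by (simp add: f_def indicator_def)
    qed
    show "f x = 0" if "x \<notin> K" for x using that by (simp add: f_def)
    have "integral\<^sup>L (lborelE n) (\<lambda>x. p x * indicator K x) = Z"
      unfolding Z_def using p0 by (intro integral_eq_nn_integral) auto
    then show "integral\<^sup>L (lborelE n) f = 1"
      using Z by (simp add: f_def[abs_def])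
  qed
  moreover have "integral\<^sup>L (lborel_on_subspace n F) f \<le> 3/2 * V ^ k * Q"
    if F: "subspace F" "F \<subseteq> topspace (Euclidean_space n)" "dim F = n - k" for F
  proof -
    \<comment> \<open>This is the very basis chosen inside \<open>lborel_on_subspace\<close>, so the
      section becomes an integral over \<open>lborelE\<close> in its coordinates.\<close>
    define b where "b = (SOME b. orthonormal_basis n F b)"
    have "orthonormal_basis n F b"
      unfolding b_def using orthonormal_basis_exists[OF F(1,2)] by (rule someI_ex)
    then have b: "orthonormal_family n (n - k) b" by (simp add: orthonormal_basis_def orthonormal_family_def F(3))
    let ?d = "n - k"
    let ?x = "\<lambda>t. \<Sum>j<?d. t j *\<^sub>R b j"
    have x_meas [measurable]: "?x \<in> borel_measurable borel"
      by (rule measurable_fun_lincomb) simp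
    \<comment> \<open>Forced by \<open>avg\<close> for the family \<open>b\<close> at hand, since a
      sum of exponentials is nonnegative.\<close>
    have Q: "Q \<ge> 0"
    proof -
      have "0 \<le> (\<Sum>i<N. exp (- sq_dist_span n ?d b (y i) / 2))" by (intro sum_nonneg) simp
      also have "\<dots> \<le> Q * N" by (rule avg[OF b])
      finally show ?thesis using N by (simp add: zero_le_mult_iff)
    qed
    \<comment> \<open>The scaling of the points and that of the variance cancel in the
      exponent.\<close>
    have sec: "(\<integral>\<^sup>+t. ennreal (g z (?x t)) \<partial>lborelE ?d) = ennreal (?G ^ ?d * exp (- sq_dist_span n ?d b w / 2))"
      if "z = c *\<^sub>R w \<or> z = - (c *\<^sub>R w)" for z w
    proof -
      have "sq_dist_span n ?d b z / (2 * c\<^sup>2) = sq_dist_span n ?d b w / 2"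
        using that c by (auto simp: sq_dist_span_scaleR)
      then show ?thesis
        unfolding g_def using nn_integral_gaussian_section[OF b, of "c\<^sup>2" z] c
        by (simp add: minus_divide_left[symmetric])
    qed
    \<comment> \<open>For an upper bound on the section the truncation to \<open>K\<close> may be
      dropped.\<close>
    have "(\<integral>\<^sup>+t. ennreal (f (?x t)) \<partial>lborelE ?d) \<le> (\<integral>\<^sup>+t. ennreal (p (?x t) * (1 / Z)) \<partial>lborelE ?d)"
      using p0 Z by (intro nn_integral_mono ennreal_leI) (auto simp: f_def indicator_def)
    also have "\<dots> = (\<integral>\<^sup>+t. ennreal (p (?x t) * 1) * ennreal (1 / Z) \<partial>lborelE ?d)"
      unfolding mult_1_right using Z by (intro nn_integral_cong ennreal_mult'') simp
    also have "\<dots> = (\<integral>\<^sup>+t. ennreal (p (?x t) * 1) \<partial>lborelE ?d) * ennreal (1 / Z)"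
      by (rule nn_integral_multc) measurable
    also have "(\<integral>\<^sup>+t. ennreal (p (?x t) * 1) \<partial>lborelE ?d) =
        (\<Sum>i<N. ennreal (?G ^ ?d * exp (- sq_dist_span n ?d b (y i) / 2)) + ennreal (?G ^ ?d * exp (- sq_dist_span n ?d b (y i) / 2)))"
      unfolding sum_p[OF zero_le_one]
      by (simp add: nn_integral_sum nn_integral_add sec[OF disjI1[OF refl]] sec[OF disjI2[OF refl]])
    also have "\<dots> = ennreal (\<Sum>i<N. 2 * (?G ^ ?d * exp (- sq_dist_span n ?d b (y i) / 2)))"
      using G by (simp add: sum_ennreal mult_ac flip: ennreal_plus)
    also have "(\<Sum>i<N. 2 * (?G ^ ?d * exp (- sq_dist_span n ?d b (y i) / 2))) =
        2 * ?G ^ ?d * (\<Sum>i<N. exp (- sq_dist_span n ?d b (y i) / 2))"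
      by (simp add: sum_distrib_left mult.assoc)
    also have "ennreal (2 * ?G ^ ?d * (\<Sum>i<N. exp (- sq_dist_span n ?d b (y i) / 2))) * ennreal (1 / Z) \<le>
        ennreal (2 * ?G ^ ?d * (Q * N)) * ennreal (1 / Z)"
      using avg[OF b] G by (intro mult_right_mono ennreal_leI mult_left_mono) auto
    also have "\<dots> = ennreal (2 * ?G ^ ?d * (Q * N) * (1 / Z))"
      using Z by (intro ennreal_mult''[symmetric]) simp
    also have "\<dots> \<le> ennreal (3/2 * V ^ k * Q)"
    proof (rule ennreal_leI)
      have "2 * ?G ^ ?d * (Q * N) * (1 / Z) \<le> 2 * ?G ^ ?d * (Q * N) * (1 / (4/3 * N * ?G ^ n))"
        using Z_low Q G N by (intro mult_left_mono divide_left_mono) (auto intro!: mult_pos_pos Z)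
      also have "?G ^ n = ?G ^ ?d * ?G ^ k" using k by (simp flip: power_add)
      also have "2 * ?G ^ ?d * (Q * N) * (1 / (4/3 * N * (?G ^ ?d * ?G ^ k))) = 3/2 * (1 / ?G) ^ k * Q"
        using G N c by (simp add: field_simps)
      also have "\<dots> \<le> 3/2 * V ^ k * Q"
      proof -
        have "1 \<le> sqrt (2 * pi)" using pi_gt3 by simp
        then have "1 * c \<le> sqrt (2 * pi) * c" using c by (intro mult_right_mono) auto
        then have "c \<le> ?G" using c by (simp add: real_sqrt_mult)
        then have "1 / ?G \<le> 1 / c" using c by (intro divide_left_mono) auto
        then have "1 / ?G \<le> V" using cV by linarith
        then show ?thesis using G Q by (intro mult_right_mono mult_left_mono power_mono) auto
      qed
      finally show "2 * ?G ^ ?d * (Q * N) * (1 / Z) \<le> 3/2 * V ^ k * Q" .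
    qed
    finally have le: "(\<integral>\<^sup>+t. ennreal (f (?x t)) \<partial>lborelE ?d) \<le> ennreal (3/2 * V ^ k * Q)" .
    have "integral\<^sup>L (lborel_on_subspace n F) f = integral\<^sup>L (lborelE ?d) (\<lambda>t. f (?x t))"
      unfolding lborel_on_subspace_def b_def[symmetric] Let_def F(3)
      by (rule integral_distr) measurable
    also have "\<dots> = enn2real (\<integral>\<^sup>+t. ennreal (f (?x t)) \<partial>lborelE ?d)"
      using f0 by (intro integral_eq_nn_integral) auto
    also have "\<dots> \<le> 3/2 * V ^ k * Q"
      using le V Q by (intro enn2real_leI) auto
    finally show ?thesis .
  qed
  ultimately show ?thesis using cb symK mK by blast
qed

section \<open>Choice of parameters in the two ranges of the codimension\<close>

text \<open>Here R = 2 sqrt (m n) and r = 2 sqrt n, so the covering radius is at most (2 + 4 + 2)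
  sqrt n and contributes exp (32 n). The \<open>m\<close>-tuples contribute exp (15 n), and 47 = 15
  + 32.\<close>

lemma emeasure_blurred_hull_le_power:
  fixes n m :: nat
  assumes fin: "finite Y" and "m > 0" and R: "\<And>y. y \<in> Y \<Longrightarrow> sqE n y \<le> 4 * m * n"
    and card: "real (card Y) ^ m \<le> exp (15 * real n)"
  shows "emeasure (lborelE n) (blurred_hull n Y (2 * sqrt n)) \<le> ennreal ((exp 47 * sqrt (2 * pi)) ^ n)"
proof -
  let ?R = "2 * (sqrt m * sqrt n)" and ?r = "2 * sqrt n"
  let ?\<rho> = "?r + (2 * ?R + ?r) / sqrt m"
  have R': "nrmE n y \<le> ?R" if "y \<in> Y" for y
  proof -
    have "nrmE n y \<le> sqrt (4 * m * n)" unfolding nrmE_def using R[OF that] by simp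
    then show ?thesis by (simp add: real_sqrt_mult)
  qed
  have m1: "1 \<le> sqrt m" using assms(2) by simp
  have "?r / sqrt m \<le> ?r / 1" using m1 by (intro divide_left_mono) auto
  moreover have "2 * ?R / sqrt m = 4 * sqrt n" using assms(2) by simp
  ultimately have "?\<rho> \<le> 8 * sqrt n" unfolding add_divide_distrib by linarith
  then have "?\<rho>\<^sup>2 \<le> (8 * sqrt n)\<^sup>2" by (intro power_mono) auto
  then have \<rho>: "?\<rho>\<^sup>2 / 2 \<le> 32 * n" by (simp add: power_mult_distrib)
  have "emeasure (lborelE n) (blurred_hull n Y ?r) \<le> ennreal (card Y ^ m * exp (?\<rho>\<^sup>2 / 2) * sqrt (2 * pi) ^ n)"
    by (rule emeasure_blurred_hull_le[OF fin R']) (use assms in auto)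
  also have "\<dots> \<le> ennreal ((exp 47 * sqrt (2 * pi)) ^ n)"
  proof (rule ennreal_leI)
    have "card Y ^ m * exp (?\<rho>\<^sup>2 / 2) * sqrt (2 * pi) ^ n \<le>
        exp (15 * real n) * exp (32 * real n) * sqrt (2 * pi) ^ n"
      using card \<rho> by (intro mult_right_mono mult_mono) auto
    also have "\<dots> = (exp 47 * sqrt (2 * pi)) ^ n"
      by (simp add: power_mult_distrib exp_of_nat_mult[symmetric] flip: exp_add)
    finally show "card Y ^ m * exp (?\<rho>\<^sup>2 / 2) * sqrt (2 * pi) ^ n \<le> (exp 47 * sqrt (2 * pi)) ^ n" .
  qed
  finally show ?thesis .
qed

text \<open>One Gaussian at the origin, with the trivial bound \<open>Q = 1\<close> on its distance
  term.\<close>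

lemma density_large_codim:
  assumes "n \<ge> 2" "k \<le> n"
  shows "\<exists>K f. convex_body n K \<and> uminus ` K = K \<and> measure (lborelE n) K = 1 \<and>
    even_continuous_density n K f \<and>
    (\<forall>F. subspace F \<and> F \<subseteq> topspace (Euclidean_space n) \<and> dim F = n - k \<longrightarrow>
      integral\<^sup>L (lborel_on_subspace n F) f \<le> 3/2 * (exp 47 * sqrt (2 * pi)) ^ k)"
proof (rule density_of_points[of n k 1 _ "\<lambda>_. 0" 1, simplified mult_1_right])
  have eq: "(\<lambda>_. 0) ` {..<1::nat} \<union> uminus ` (\<lambda>_. 0) ` {..<1} = {0 :: nat \<Rightarrow> real}"
    by auto
  show "emeasure (lborelE n) (blurred_hull n ((\<lambda>_. 0) ` {..<1::nat} \<union> uminus ` (\<lambda>_. 0) ` {..<1}) (2 * sqrt (real n)))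
      \<le> ennreal ((exp 47 * sqrt (2 * pi)) ^ n)"
    unfolding eq by (rule emeasure_blurred_hull_le_power[of _ 1]) auto
qed (use assms in \<open>auto simp: topspace_Euclidean_space sq_dist_span_def\<close>)

text \<open>The number \<open>m\<close> is both the variance per coordinate of the points and the
  tuple length in Maurey's method. The exponent 14 k of \<open>N\<close> is 11 k for the logarithm
  of the net size plus 3 k for \<open>sqrt (1 + m) ^ k\<close>. It is still small enough that the
  \<open>m\<close>-tuples from the at most \<open>2 * N\<close> points number at most exp (15
  n).\<close>

lemma density_small_codim:
  assumes n: "n \<ge> 2" and k: "1 \<le> k" "k \<le> n" and small: "real k * ln n \<le> n"
  shows "\<exists>K f. convex_body n K \<and> uminus ` K = K \<and> measure (lborelE n) K = 1 \<and>
    even_continuous_density n K f \<and>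
    (\<forall>F. subspace F \<and> F \<subseteq> topspace (Euclidean_space n) \<and> dim F = n - k \<longrightarrow>
      integral\<^sup>L (lborel_on_subspace n F) f \<le>
        3/2 * (exp 47 * sqrt (2 * pi)) ^ k * (12 * sqrt (2 * (real k * ln n / n)) ^ k))"
proof -
  define t where "t = real n / (real k * ln n)"
  have ln2: "1/2 \<le> ln (real n)"
  proof -
    have "exp (1/2 :: real) \<le> 2"
      using exp_bound[of "1/2"] by (simp add: power2_eq_square)
    then show ?thesis using n by (subst ln_ge_iff) auto
  qed
  have kl: "real k * ln n > 0" using k ln2 n by (intro mult_pos_pos) auto
  have t1: "1 \<le> t" using small kl by (simp add: t_def le_divide_eq)
  \<comment> \<open>Rounding down: \<open>m_le\<close> feeds the volume bound through
    \<open>km\<close>, and \<open>m_gt\<close> feeds the bound for the sections.\<close>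
  define m where "m = nat \<lfloor>t\<rfloor>"
  have "real m = of_int \<lfloor>t\<rfloor>" unfolding m_def using t1 by (intro of_nat_nat) simp
  then have m_le: "real m \<le> t" and m_gt: "t < real m + 1" by linarith+
  then have m0: "m \<ge> 1" using t1 by linarith
  have km: "real k * ln n * m \<le> n" using m_le kl by (simp add: t_def pos_le_divide_eq mult.commute)
  have m2n: "real m \<le> 2 * n"
  proof -
    have "1/2 * real m \<le> (real k * ln n) * m"
      using ln2 k mult_mono[of 1 "real k" "1/2" "ln n"] by (intro mult_right_mono) auto
    then show ?thesis using km by simp
  qed
  define N where "N = n ^ (14 * k)"
  have npow: "real n ^ a \<le> real n ^ b" if "a \<le> b" for a b
    using that n by (intro power_increasing) auto
  have "\<exists>y. (\<forall>i<N. y i \<in> topspace (Euclidean_space n) \<and> sqE n (y i) \<le> 4 * real m * n) \<and>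
    (\<forall>b. orthonormal_family n (n - k) b \<longrightarrow>
      (\<Sum>i<N. exp (- sq_dist_span n (n - k) b (y i) / 2)) \<le> 12 * real N / sqrt (1 + real m) ^ (n - (n - k)))"
  \<comment> \<open>As \<open>m\<close> is at most \<open>2 * n\<close>, the requirement on the net,
    8 m n^3 \<le> M, is met by M = 16 n^4.\<close>
  proof (rule exists_spread_points[where M="16 * n ^ 4"])
    have "8 * real m * real n ^ 3 \<le> 8 * (2 * n) * real n ^ 3"
      using m2n by (intro mult_right_mono mult_left_mono) auto
    then show "8 * real m * real n ^ 3 \<le> real (16 * n ^ 4)" by (simp add: power_def)
    have "sqrt (1 + real m) \<le> 1 + real m" by (intro real_le_lsqrt) (auto simp: power2_eq_square field_simps)
    also have "\<dots> \<le> 1 + 2 * n" using m2n by simp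
    also have "\<dots> \<le> real n ^ 3"
    proof -
      have "4 * real n \<le> real n * real n * real n"
        using n mult_mono[of 2 "real n" 2 "real n"] by (intro mult_right_mono) auto
      moreover have "1 + 2 * real n \<le> 4 * real n" using n by simp
      ultimately show ?thesis unfolding power3_eq_cube by linarith
    qed
    finally have "sqrt (1 + real m) ^ k \<le> (real n ^ 3) ^ k" by (intro power_mono) auto
    also have "(real n ^ 3) ^ k = real n ^ (3 * k)" by (simp flip: power_mult)
    finally have sq: "sqrt (1 + real m) ^ k \<le> real n ^ (3 * k)" .
    \<comment> \<open>By ln (1 + x) \<le> x the left side is at most 32 n^6, and 32 = 2^5 is at most
      n^5.\<close>
    have "real (n * n) * ln (2 * real (16 * n ^ 4) + 1) \<le> real (n * n) * (2 * real (16 * n ^ 4))"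
      using ln_add_one_self_le_self[of "2 * real (16 * n ^ 4)"]
      by (intro mult_left_mono) (auto simp: add.commute)
    also have "\<dots> = 2 ^ 5 * real n ^ 6" by (simp add: eval_nat_numeral)
    also have "\<dots> \<le> real n ^ 5 * real n ^ 6" using n by (intro mult_right_mono power_mono) auto
    also have "\<dots> = real n ^ 11" by (simp flip: power_add)
    also have "\<dots> \<le> real n ^ (11 * k)" using k by (intro npow) auto
    also have "\<dots> = real N / real n ^ (3 * k)"
      using n by (simp add: N_def field_simps flip: power_add)
    also have "\<dots> \<le> real N / sqrt (1 + real m) ^ k"
      using sq n by (intro divide_left_mono) auto
    finally show "real (n * n) * ln (2 * real (16 * n ^ 4) + 1) \<le> real N / sqrt (1 + real m) ^ (n - (n - k))"
      using k by simp
  qed (use n m0 in auto)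
  then obtain y where y: "\<And>i. i < N \<Longrightarrow> y i \<in> topspace (Euclidean_space n)"
      "\<And>i. i < N \<Longrightarrow> sqE n (y i) \<le> 4 * real m * n"
    and avg: "\<And>b. orthonormal_family n (n - k) b \<Longrightarrow>
      (\<Sum>i<N. exp (- sq_dist_span n (n - k) b (y i) / 2)) \<le> 12 * real N / sqrt (1 + real m) ^ (n - (n - k))"
    by blast
  show ?thesis
  proof (rule density_of_points[OF n k(2), of N])
    let ?Y = "y ` {..<N} \<union> uminus ` y ` {..<N}"
    show "emeasure (lborelE n) (blurred_hull n ?Y (2 * sqrt n)) \<le> ennreal ((exp 47 * sqrt (2 * pi)) ^ n)"
    proof (rule emeasure_blurred_hull_le_power)
      have "card ?Y \<le> card (y ` {..<N}) + card (uminus ` y ` {..<N})" by (rule card_Un_le)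
      also have "\<dots> \<le> N + N"
        using card_image_le[of "{..<N}" y] card_image_le[of "y ` {..<N}" uminus] by simp
      finally have "real (card ?Y) \<le> 2 * real N" by simp
      \<comment> \<open>The doubling of the points by symmetry costs one power of \<open>n\<close>,
        covered by passing from 14 k + 1 to 15 k.\<close>
      also have "\<dots> \<le> real n * real N" using n by (intro mult_right_mono) auto
      also have "\<dots> = real n ^ (14 * k + 1)" by (simp add: N_def)
      also have "\<dots> \<le> real n ^ (15 * k)" using k by (intro npow) auto
      finally have "real (card ?Y) ^ m \<le> (real n ^ (15 * k)) ^ m" by (intro power_mono) auto
      also have "\<dots> = exp (ln (real n ^ (15 * k * m)))" using n by (simp add: power_mult)
      also have "ln (real n ^ (15 * k * m)) = 15 * (real k * ln n * m)"
        using n by (subst ln_realpow) auto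
      also have "exp (15 * (real k * ln n * m)) \<le> exp (15 * real n)" using km by simp
      finally show "real (card ?Y) ^ m \<le> exp (15 * real n)" .
    qed (use y m0 in auto)
    fix b assume b: "orthonormal_family n (n - k) b"
    have "1 / sqrt (1 + real m) \<le> sqrt (2 * (real k * ln n / n))"
    proof -
      have "1 / (1 + real m) \<le> 1 / t"
        using m_gt t1 by (intro divide_left_mono) auto
      also have "\<dots> = real k * ln n / n" by (simp add: t_def)
      also have "\<dots> \<le> 2 * (real k * ln n / n)"
        using kl mult_right_mono[of 1 2 "real k * ln n / n"] by simp
      finally have "sqrt (1 / (1 + real m)) \<le> sqrt (2 * (real k * ln n / n))"
        using real_sqrt_le_iff by blast
      then show ?thesis by (simp add: real_sqrt_divide)
    qed
    then have "(1 / sqrt (1 + real m)) ^ k \<le> sqrt (2 * (real k * ln n / n)) ^ k"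
      by (intro power_mono) auto
    then have "12 * real N * (1 / sqrt (1 + real m)) ^ k \<le> 12 * real N * sqrt (2 * (real k * ln n / n)) ^ k"
      by (intro mult_left_mono) auto
    then show "(\<Sum>i<N. exp (- sq_dist_span n (n - k) b (y i) / 2)) \<le> 12 * sqrt (2 * (real k * ln n / n)) ^ k * real N"
      using avg[OF b] k by (simp add: power_divide mult_ac)
  qed (use n y N_def in auto)
qed

theorem theorem1p4:
  shows "\<exists>c::real. c > 0 \<and>
    (\<forall>n k :: nat. n \<ge> 2 \<and> 1 \<le> k \<and> k \<le> n - 1 \<longrightarrow>
      (\<exists>(K :: (nat \<Rightarrow> real) set) (f :: (nat \<Rightarrow> real) \<Rightarrow> real).
        convex_body n K \<and> uminus ` K = K \<and> measure (lborelE n) K = 1 \<and>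
        even_continuous_density n K f \<and>
        (\<forall>F. subspace F \<and> F \<subseteq> topspace (Euclidean_space n) \<and> dim F = n - k \<longrightarrow>
          integral\<^sup>L (lborel_on_subspace n F) f
            \<le> (c * sqrt (real k * ln (real n) / real n)) ^ k)))"
proof -
  define V where "V = exp 47 * sqrt (2 * pi)"
  have V: "V > 0" by (simp add: V_def)
  show ?thesis
  \<comment> \<open>The constant is 36 = 18 * 2: the prefactor 3/2 * 12 = 18 is at most
    \<open>18 ^ k\<close> since \<open>k\<close> is positive, and \<open>sqrt 2\<close> is bounded
    by 2.\<close>
  proof (rule exI[of _ "36 * V"], intro conjI allI impI)
    show "36 * V > 0" using V by simp
    fix n k :: nat assume nk: "n \<ge> 2 \<and> 1 \<le> k \<and> k \<le> n - 1"
    let ?X = "sqrt (real k * ln (real n) / real n)"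
    let ?P = "\<lambda>C. \<exists>K f. convex_body n K \<and> uminus ` K = K \<and> measure (lborelE n) K = 1 \<and>
        even_continuous_density n K f \<and>
        (\<forall>F. subspace F \<and> F \<subseteq> topspace (Euclidean_space n) \<and> dim F = n - k \<longrightarrow>
          integral\<^sup>L (lborel_on_subspace n F) f \<le> C)"
    have mono: "?P C'" if "?P C" "C \<le> C'" for C C'
      using that by (meson order_trans)
    show "?P ((36 * V * ?X) ^ k)"
    proof (cases "real k * ln n \<le> n")
      case True
      have X: "?X \<ge> 0" using nk by simp
      have "3/2 * V ^ k * (12 * sqrt (2 * (real k * ln n / n)) ^ k) = 18 * (V * (sqrt 2 * ?X)) ^ k"
        unfolding real_sqrt_mult[of 2] by (simp add: power_mult_distrib)
      also have "\<dots> \<le> 18 ^ k * (V * (2 * ?X)) ^ k"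
      proof (rule mult_mono)
        show "(18::real) \<le> 18 ^ k" using nk self_le_power[of "18::real" k] by simp
        have "sqrt 2 \<le> 2" by (rule real_le_lsqrt) auto
        then show "(V * (sqrt 2 * ?X)) ^ k \<le> (V * (2 * ?X)) ^ k"
          using V X by (intro power_mono mult_left_mono mult_right_mono) auto
      qed (use V X in auto)
      also have "\<dots> = (36 * V * ?X) ^ k" by (simp flip: power_mult_distrib add: mult_ac)
      finally have le: "3/2 * V ^ k * (12 * sqrt (2 * (real k * ln n / n)) ^ k) \<le> (36 * V * ?X) ^ k" .
      show ?thesis
        by (rule mono[OF density_small_codim[folded V_def] le]) (use nk True in auto)
    next
      case False
      \<comment> \<open>In this range the square root in the target is at least 1, so a bound of the
        form \<open>C ^ k\<close> for the sections suffices.\<close>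
      have "real k * ln n / n \<ge> 1" using False nk by (simp add: le_divide_eq)
      then have X: "?X \<ge> 1" by simp
      have "3/2 * V ^ k \<le> 36 ^ k * V ^ k"
      proof -
        have "3/2 \<le> (36::real) ^ k" using nk self_le_power[of "36::real" k] by simp
        then show ?thesis using V mult_right_mono[of "3/2" "36 ^ k" "V ^ k"] by simp
      qed
      also have "\<dots> = (36 * V * 1) ^ k" by (simp add: power_mult_distrib)
      also have "\<dots> \<le> (36 * V * ?X) ^ k" using X V by (intro power_mono mult_left_mono) auto
      finally have le: "3/2 * V ^ k \<le> (36 * V * ?X) ^ k" .
      show ?thesis
        by (rule mono[OF density_large_codim[folded V_def] le]) (use nk in auto)
    qed
  qed
qed

end
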